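(* Let $V\in L^\infty(\mathbb{R})$ satisfy $0<v_0\le V(x)\le v_1$ for a.e. $x\in\mathbb{R}$, for some constants $v_0,v_1$. Then there exist unique functions $\varphi_+,\varphi_-\in W^{2,\infty}_{loc}(\mathbb{R})$ such that $$\varphi_\pm''(x)=V(x)\varphi_\pm(x)\ \ (\text{a.e. }x\in\mathbb{R}),\qquad \varphi_\pm(0)=1,\qquad \lim_{x\to\pm\infty}\varphi_\pm(x)=0,$$ where the upper signs are taken for $\varphi_+$ and the lower signs for $\varphi_-$. Furthermore, for all $x\in\mathbb{R}$, $$\sqrt{\frac{v_0}{v_1}}\,e^{-\max(\sqrt{v_0}x,\sqrt{v_1}x)}\le\varphi_+(x)\le\sqrt{\frac{v_1}{v_0}}\,e^{-\min(\sqrt{v_0}x,\sqrt{v_1}x)},$$ $$\sqrt{\frac{v_0}{v_1}}\,e^{\min(\sqrt{v_0}x,\sqrt{v_1}x)}\le\varphi_-(x)\le\sqrt{\frac{v_1}{v_0}}\,e^{\max(\sqrt{v_0}x,\sqrt{v_1}x)}.$$ Moreover, for every $a\in\mathbb{R}$, $$u_a(x)=\begin{cases}\dfrac{\varphi_-(x)}{\varphi_-(a)} & (x<a),\\[8pt] \dfrac{\varphi_+(x)}{\varphi_+(a)} & (x\ge a).\end{cases}$$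
   Context: All function spaces are real-valued, $H^1(\mathbb{R})=W^{1,2}(\mathbb{R})$, and Sobolev functions are identified with their continuous representatives. Write $\|u\|_\infty=\|u\|_{L^\infty(\mathbb{R})}$ and $\|u\|_V^2=\int_{\mathbb{R}}(|u'|^2+V|u|^2)\,dx$. For $a\in\mathbb{R}$ set $K_a:=\{u\in H^1(\mathbb{R}):\ u(a)=\|u\|_\infty=1\}$, and let $u_a$ be the unique minimizer of $\|u\|_V^2$ over $u\in K_a$ (it exists and is unique). *)

theory Defs
  imports "HOL-Analysis.Analysis" "HOL-Probability.Essential_Supremum"
begin

definition L2 :: "(real \<Rightarrow> real) set" where
  "L2 = {f \<in> borel_measurable lebesgue. integrable lebesgue (\<lambda>x. \<bar>f x\<bar>\<^sup>2)}"

definition Linf_norm :: "(real \<Rightarrow> real) \<Rightarrow> ereal" where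
  "Linf_norm f = esssup lebesgue (\<lambda>x. ereal \<bar>f x\<bar>)"

definition Linf :: "(real \<Rightarrow> real) set" where
  "Linf = {f \<in> borel_measurable lebesgue. Linf_norm f < \<infinity>}"

definition Linf_loc :: "(real \<Rightarrow> real) set" where
  "Linf_loc = {f. \<forall>K. compact K \<longrightarrow> (\<lambda>x. indicator K x * f x) \<in> Linf}"

definition L1_loc :: "(real \<Rightarrow> real) set" where
  "L1_loc = {f. \<forall>K. compact K \<longrightarrow> f absolutely_integrable_on K}"

definition test_function :: "(real \<Rightarrow> real) \<Rightarrow> bool" where
  "test_function \<psi> \<longleftrightarrow>
     (\<forall>k. (deriv ^^ k) \<psi> differentiable_on UNIV) \<and> compact (closure {x. \<psi> x \<noteq> 0})"

definition has_weak_deriv :: "nat \<Rightarrow> (real \<Rightarrow> real) \<Rightarrow> (real \<Rightarrow> real) \<Rightarrow> bool" where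
  "has_weak_deriv k f g \<longleftrightarrow> f \<in> L1_loc \<and> g \<in> L1_loc \<and>
     (\<forall>\<psi>. test_function \<psi> \<longrightarrow>
        (LINT x|lebesgue. f x * (deriv ^^ k) \<psi> x) = (-1) ^ k * (LINT x|lebesgue. g x * \<psi> x))"

(* Weak derivatives are unique only up to a null set, so this picks an arbitrary representative;
   it is used only under integrals and in almost-everywhere statements. *)
definition weak_deriv :: "nat \<Rightarrow> (real \<Rightarrow> real) \<Rightarrow> real \<Rightarrow> real" where
  "weak_deriv k f = (SOME g. has_weak_deriv k f g)"

(* The Sobolev space of order k (k >= 1) over X, where X is L2, Linf_loc, etc. Its elements are
   the continuous representatives, so that equality of elements is equality of functions.
   The case j = 0 says that f itself agrees almost everywhere with an element of X. *)
definition sobolev :: "nat \<Rightarrow> (real \<Rightarrow> real) set \<Rightarrow> (real \<Rightarrow> real) set" where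
  "sobolev k X = {f. continuous_on UNIV f \<and> (\<forall>j\<le>k. \<exists>g\<in>X. has_weak_deriv j f g)}"

definition H1 :: "(real \<Rightarrow> real) set" where
  "H1 = sobolev 1 L2"

definition W2inf_loc :: "(real \<Rightarrow> real) set" where
  "W2inf_loc = sobolev 2 Linf_loc"

definition V_norm_sq :: "(real \<Rightarrow> real) \<Rightarrow> (real \<Rightarrow> real) \<Rightarrow> real" where
  "V_norm_sq V u = (LINT x|lebesgue. \<bar>weak_deriv 1 u x\<bar>\<^sup>2 + V x * \<bar>u x\<bar>\<^sup>2)"

definition K_set :: "real \<Rightarrow> (real \<Rightarrow> real) set" where
  "K_set a = {u \<in> H1. u a = 1 \<and> Linf_norm u = 1}"

definition is_minimizer :: "(real \<Rightarrow> real) \<Rightarrow> real \<Rightarrow> (real \<Rightarrow> real) \<Rightarrow> bool" where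
  "is_minimizer V a u \<longleftrightarrow> is_arg_min (V_norm_sq V) (\<lambda>w. w \<in> K_set a) u"

definition minimizer :: "(real \<Rightarrow> real) \<Rightarrow> real \<Rightarrow> real \<Rightarrow> real" where
  "minimizer V a = (THE u. is_minimizer V a u)"

(* F is at_top for the solution decaying at plus infinity, at_bot for the one decaying at
   minus infinity. *)
definition decaying_solution :: "(real \<Rightarrow> real) \<Rightarrow> real filter \<Rightarrow> (real \<Rightarrow> real) \<Rightarrow> bool" where
  "decaying_solution V F \<phi> \<longleftrightarrow> \<phi> \<in> W2inf_loc \<and>
     (AE x in lebesgue. weak_deriv 2 \<phi> x = V x * \<phi> x) \<and> \<phi> 0 = 1 \<and> (\<phi> \<longlongrightarrow> 0) F"

end

theory Submission
  imports Defs
begin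

text \<open>
Everything rests on replacing weak derivatives by honest integrals. Write \<open>ac_deriv f g\<close> when
\<open>f\<close> is an indefinite integral of the locally integrable function \<open>g\<close>. For continuous \<open>f\<close>,
having \<open>g\<close> as first weak derivative is the same as \<open>ac_deriv f g\<close>, and having \<open>g\<close> as second
weak derivative is the same as having a continuous \<open>f'\<close> with \<open>ac_deriv f f'\<close> and
\<open>ac_deriv f' g\<close> (\<open>has_weak_deriv_1_iff\<close>, \<open>has_weak_deriv_2_iff\<close>). This is the lemma of
du Bois-Reymond; its proof tests with explicit antiderivatives of a smooth mollifier. After
replacing \<open>V\<close> by its truncation to \<open>[v0, v1]\<close>, which changes it only on a null set, the equation
becomes a linear ordinary differential equation \<open>u'' = V u\<close> in integrated form, called \<open>solves\<close>.

The qualitative theory of that equation follows from one observation: \<open>(u u')' = u'\<^sup>2 + V u\<^sup>2 \<ge> 0\<close>,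
so \<open>u u'\<close> is nondecreasing and \<open>u\<^sup>2\<close> is convex. A solution that is bounded near \<open>+\<infinity>\<close> therefore
has \<open>u u' \<le> 0\<close> everywhere, and then it even tends to 0, because otherwise \<open>(u u')'\<close> would stay
above a positive constant. A solution with two zeros vanishes, and so does a decaying solution with
one zero. Uniqueness of \<open>\<phi>\<^sub>+\<close> and its positivity are immediate. For existence, let \<open>\<phi>\<^sub>n\<close> be the
solution with \<open>\<phi>\<^sub>n(0) = 1\<close> and \<open>\<phi>\<^sub>n(n) = 0\<close>; the monotonicity of \<open>u u'\<close> gives
\<open>\<bar>\<phi>\<^sub>n\<bar> \<le> 1\<close> on \<open>[0, n]\<close>, so the slopes at 0 are bounded and a limit point of them produces a
solution bounded on the half line.

For the exponential bounds put \<open>k = sqrt v0\<close>. The function \<open>w = u' + k u\<close> satisfies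
\<open>w' - k w = (V - v0) u \<ge> 0\<close>, so a positive value of \<open>w\<close> would persist and grow to the right, which
is incompatible with \<open>u' \<le> 0\<close> and \<open>u \<rightarrow> 0\<close>. Hence \<open>u' \<le> - sqrt v0 u\<close>, and in the same way
\<open>u' \<ge> - sqrt v1 u\<close>. Integrating from 0 gives the claimed bounds with constant 1 in place of
\<open>sqrt (v1 / v0)\<close> and \<open>sqrt (v0 / v1)\<close>. The solution \<open>\<phi>\<^sub>-\<close> is \<open>\<phi>\<^sub>+\<close> for the potential
\<open>V (- x)\<close>, read backwards.

For the variational part, let \<open>u\<close> be the function glued at \<open>a\<close> from the two normalized solutions. It
lies in \<open>K_set a\<close> by the exponential bounds. If \<open>w\<close> is any competitor, then \<open>h = w - u\<close> vanishes at
\<open>a\<close>, so integrating \<open>u'h' + V u h = (u' h)'\<close> over the two half lines leaves no boundary term and the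
mixed term of the quadratic form is zero (\<open>cross_term_vanishes\<close>). Hence
\<open>\<parallel>w\<parallel>\<^sup>2 = \<parallel>u\<parallel>\<^sup>2 + \<parallel>h\<parallel>\<^sup>2\<close>, which makes \<open>u\<close> the one and only minimizer.
\<close>

section \<open>Locally absolutely continuous functions\<close>

text \<open>
The pair \<open>f\<close>, \<open>g\<close> plays the role of a locally absolutely continuous function and its almost
everywhere derivative. Stating it through integrals makes sums, monotonicity and changes of \<open>g\<close> on
null sets immediate, without a theorem on differentiation almost everywhere.
\<close>

definition ac_deriv :: "(real \<Rightarrow> real) \<Rightarrow> (real \<Rightarrow> real) \<Rightarrow> bool" where
  "ac_deriv f g \<longleftrightarrow>
     (\<forall>a b. a \<le> b \<longrightarrow> g absolutely_integrable_on {a..b} \<and> f b - f a = integral {a..b} g)"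

lemma ac_deriv_abs_integrable:
  assumes "ac_deriv f g"
  shows "g absolutely_integrable_on {a..b}"
  using assms by (cases "a \<le> b") (auto simp: ac_deriv_def)

lemma ac_deriv_has_integral:
  assumes "ac_deriv f g" "a \<le> b"
  shows "(g has_integral (f b - f a)) {a..b}"
proof -
  have "g integrable_on {a..b}"
    using ac_deriv_abs_integrable[OF assms(1)] set_lebesgue_integral_eq_integral(1) by blast
  then show ?thesis
    using assms by (auto simp: ac_deriv_def has_integral_integral)
qed

lemma ac_deriv_eq_add_integral:
  assumes "ac_deriv f g" "a \<le> b"
  shows "f b = f a + integral {a..b} g"
  using assms unfolding ac_deriv_def by (metis add.commute diff_add_cancel)

lemma ac_derivI:
  assumes "\<And>a b. a \<le> b \<Longrightarrow> g absolutely_integrable_on {a..b}"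
    and "\<And>a b. a \<le> b \<Longrightarrow> (g has_integral (f b - f a)) {a..b}"
  shows "ac_deriv f g"
  unfolding ac_deriv_def using assms by (auto intro!: integral_unique[symmetric])

lemma ac_deriv_continuous:
  assumes "ac_deriv f g"
  shows "continuous_on UNIV f"
proof -
  have "isCont f x" for x
  proof -
    have "g integrable_on {x-1..x+1}"
      using ac_deriv_abs_integrable[OF assms] set_lebesgue_integral_eq_integral(1) by blast
    then have "continuous_on {x-1..x+1} (\<lambda>y. f (x-1) + integral {x-1..y} g)"
      by (intro continuous_intros indefinite_integral_continuous_1)
    moreover have "f (x-1) + integral {x-1..y} g = f y" if "y \<in> {x-1..x+1}" for y
      using that ac_deriv_eq_add_integral[OF assms, of "x-1" y] by auto
    ultimately have "continuous_on {x-1..x+1} f"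
      by (metis (no_types, lifting) continuous_on_cong)
    then show "isCont f x"
      by (rule continuous_on_interior) auto
  qed
  then show ?thesis
    by (simp add: continuous_at_imp_continuous_on)
qed

lemma ac_deriv_add:
  assumes "ac_deriv f f'" "ac_deriv g g'"
  shows "ac_deriv (\<lambda>x. f x + g x) (\<lambda>x. f' x + g' x)"
proof (rule ac_derivI)
  fix a b :: real assume "a \<le> b"
  show "(\<lambda>x. f' x + g' x) absolutely_integrable_on {a..b}"
    using assms by (intro set_integral_add(1) ac_deriv_abs_integrable)
  show "((\<lambda>x. f' x + g' x) has_integral f b + g b - (f a + g a)) {a..b}"
    using has_integral_add[OF ac_deriv_has_integral[OF assms(1) \<open>a \<le> b\<close>]
        ac_deriv_has_integral[OF assms(2) \<open>a \<le> b\<close>]] by (simp add: algebra_simps)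
qed

lemma ac_deriv_cmul:
  assumes "ac_deriv f f'"
  shows "ac_deriv (\<lambda>x. c * f x) (\<lambda>x. c * f' x)"
proof (rule ac_derivI)
  fix a b :: real assume "a \<le> b"
  show "(\<lambda>x. c * f' x) absolutely_integrable_on {a..b}"
    using assms by (intro set_integrable_mult_right ac_deriv_abs_integrable)
  show "((\<lambda>x. c * f' x) has_integral c * f b - c * f a) {a..b}"
    using has_integral_mult_right[OF ac_deriv_has_integral[OF assms(1) \<open>a \<le> b\<close>], of c]
    by (simp add: algebra_simps)
qed

lemma ac_deriv_diff:
  assumes "ac_deriv f f'" "ac_deriv g g'"
  shows "ac_deriv (\<lambda>x. f x - g x) (\<lambda>x. f' x - g' x)"
  using ac_deriv_add[OF assms(1) ac_deriv_cmul[OF assms(2), of "-1"]] by simp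

lemma ac_deriv_cong_AE:
  assumes "ac_deriv f g" "AE x in lebesgue. g x = h x"
  shows "ac_deriv f h"
proof (rule ac_derivI)
  fix a b :: real assume "a \<le> b"
  obtain N where N: "N \<in> null_sets lebesgue" "\<And>x. x \<in> space lebesgue - N \<Longrightarrow> g x = h x"
    using AE_E3[OF assms(2)] by metis
  then have N: "negligible N" and eq: "\<And>x. x \<in> {a..b} - N \<Longrightarrow> h x = g x"
    by (auto simp: negligible_iff_null_sets)
  show "h absolutely_integrable_on {a..b}"
    using absolutely_integrable_spike[OF ac_deriv_abs_integrable[OF assms(1)] N eq] by blast
  show "(h has_integral f b - f a) {a..b}"
    using has_integral_spike[OF N eq ac_deriv_has_integral[OF assms(1) \<open>a \<le> b\<close>]] by blast
qed

lemma ac_deriv_of_continuous_derivative: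
  assumes "\<And>x. (f has_real_derivative g x) (at x)" "continuous_on UNIV g"
  shows "ac_deriv f g"
proof (rule ac_derivI)
  fix a b :: real assume "a \<le> b"
  show "g absolutely_integrable_on {a..b}"
    using assms(2) by (intro absolutely_integrable_continuous_real) (auto intro: continuous_on_subset)
  show "(g has_integral f b - f a) {a..b}"
    using \<open>a \<le> b\<close> assms(1)
    by (intro fundamental_theorem_of_calculus)
      (auto simp flip: has_real_derivative_iff_has_vector_derivative intro: DERIV_subset)
qed

lemma ac_deriv_const: "ac_deriv (\<lambda>x. c) (\<lambda>x. 0)"
  by (rule ac_deriv_of_continuous_derivative) (auto intro!: continuous_intros)

lemma ac_deriv_imp_has_real_derivative:
  assumes "ac_deriv f g" "continuous_on UNIV g"
  shows "(f has_real_derivative g x) (at x)"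
proof -
  have "((\<lambda>y. f (x-1) + integral {x-1..y} g) has_real_derivative 0 + g x) (at x within {x-1..x+1})"
    using assms(2)
    by (intro DERIV_add DERIV_const integral_has_real_derivative) (auto intro: continuous_on_subset)
  then have "(f has_real_derivative g x) (at x within {x-1..x+1})"
    unfolding add_0
  proof (rule has_field_derivative_transform_within[where d = 1])
    fix y assume "y \<in> {x-1..x+1}"
    then show "f (x-1) + integral {x-1..y} g = f y"
      using ac_deriv_eq_add_integral[OF assms(1), of "x-1" y] by simp
  qed auto
  then show ?thesis
    by (simp add: at_within_Icc_at)
qed

lemma ac_deriv_mono:
  assumes "ac_deriv f g" "a \<le> b" "\<And>x. x \<in> {a..b} \<Longrightarrow> 0 \<le> g x"
  shows "f a \<le> f b"
  using has_integral_nonneg[OF ac_deriv_has_integral[OF assms(1,2)]] assms(3) by simp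

lemma ac_deriv_antimono:
  assumes "ac_deriv f g" "a \<le> b" "\<And>x. x \<in> {a..b} \<Longrightarrow> g x \<le> 0"
  shows "f b \<le> f a"
  using ac_deriv_mono[OF ac_deriv_cmul[OF assms(1), of "-1"] assms(2)] assms(3) by simp

lemma ac_deriv_reflect:
  assumes "ac_deriv f g"
  shows "ac_deriv (\<lambda>x. f (- x)) (\<lambda>x. - g (- x))"
proof (rule ac_derivI)
  fix a b :: real assume "a \<le> b"
  have "(\<lambda>x. g (- x)) absolutely_integrable_on {- (-a).. - (-b)}"
    unfolding absolutely_integrable_reflect_real by (rule ac_deriv_abs_integrable[OF assms])
  then have "(\<lambda>x. (-1) * g (- x)) absolutely_integrable_on {a..b}"
    by (intro set_integrable_mult_right) simp
  then show "(\<lambda>x. - g (- x)) absolutely_integrable_on {a..b}" by simp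
  have "((\<lambda>x. g (- x)) has_integral (f (-a) - f (-b))) {- (-a).. - (-b)}"
    unfolding has_integral_reflect_real using \<open>a \<le> b\<close> by (intro ac_deriv_has_integral[OF assms]) auto
  from has_integral_neg[OF this]
  show "((\<lambda>x. - g (- x)) has_integral f (- b) - f (- a)) {a..b}" by simp
qed

lemma abs_integrable_continuous_mult:
  fixes f g :: "real \<Rightarrow> real"
  assumes "continuous_on UNIV f" "g absolutely_integrable_on {a..b}"
  shows "(\<lambda>x. f x * g x) absolutely_integrable_on {a..b}"
proof (rule absolutely_integrable_bounded_measurable_product_real)
  have c: "continuous_on {a..b} f" using assms(1) continuous_on_subset by blast
  then show "f \<in> borel_measurable (lebesgue_on {a..b})"
    by (intro continuous_imp_measurable_on_sets_lebesgue) auto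
  show "bounded (f ` {a..b})"
    using c compact_Icc compact_continuous_image compact_imp_bounded by blast
qed (use assms in auto)

lemma bounded_image_Icc_of_continuous:
  fixes f :: "real \<Rightarrow> real"
  assumes "continuous_on UNIV f"
  shows "bounded (f ` {a..b})"
  using assms
  by (meson compact_Icc compact_continuous_image compact_imp_bounded continuous_on_subset subset_UNIV)

text \<open>
Local boundedness of \<open>g\<close> gives an elementary proof: the difference \<open>H\<close> between
the integral of the expected derivative and \<open>F G\<close> changes on \<open>[x, y]\<close> by at most a constant times
\<open>(y - x)\<close> times the integral of \<open>\<bar>f\<bar>\<close> over \<open>[x, y]\<close>. The second factor tends to 0 as
\<open>y \<rightarrow> x\<close>, so \<open>H\<close> has derivative 0 at every point and is constant.
\<close>

lemma ac_deriv_mult: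
  assumes F: "ac_deriv F f" and G: "ac_deriv G g"
    and bdd: "\<And>a b. bounded (g ` {a..b})"
  shows "ac_deriv (\<lambda>x. F x * G x) (\<lambda>x. f x * G x + F x * g x)"
proof -
  let ?k = "\<lambda>x. f x * G x + F x * g x"
  note cF = ac_deriv_continuous[OF F] and cG = ac_deriv_continuous[OF G]
  have k: "?k absolutely_integrable_on {a..b}" for a b
    using abs_integrable_continuous_mult[OF cG ac_deriv_abs_integrable[OF F]]
      abs_integrable_continuous_mult[OF cF ac_deriv_abs_integrable[OF G]]
    by (intro set_integral_add(1)) (simp_all add: mult.commute)
  have kint: "?k integrable_on {a..b}" for a b
    using k set_lebesgue_integral_eq_integral(1) by blast
  have absf: "(\<lambda>t. \<bar>f t\<bar>) integrable_on {a..b}" for a b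
    using ac_deriv_abs_integrable[OF F] unfolding absolutely_integrable_on_def by auto
  have "integral {a..b} ?k = F b * G b - F a * G a" if "a \<le> b" for a b
  proof -
    obtain M where M: "M \<ge> 0" "\<And>t. t \<in> {a..b} \<Longrightarrow> \<bar>g t\<bar> \<le> M"
    proof -
      obtain M0 where "\<forall>y \<in> g ` {a..b}. norm y \<le> M0"
        using bdd bounded_iff by blast
      then show ?thesis using that[of "max 0 M0"] by force
    qed
    define H where "H x = integral {a..x} ?k - F x * G x" for x
    define \<Phi> where "\<Phi> x = integral {a..x} (\<lambda>t. \<bar>f t\<bar>)" for x
    have key: "\<bar>H y - H x\<bar> \<le> 2 * M * \<bar>\<Phi> y - \<Phi> x\<bar> * (y - x)" if xy: "a \<le> x" "x \<le> y" "y \<le> b" for x y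
    proof -
      have \<Phi>: "\<Phi> y - \<Phi> x = integral {x..y} (\<lambda>t. \<bar>f t\<bar>)"
        using Henstock_Kurzweil_Integration.integral_combine[OF xy(1,2) absf] by (simp add: \<Phi>_def)
      have dF: "\<bar>F t - F s\<bar> \<le> \<Phi> y - \<Phi> x" if "x \<le> s" "s \<le> t" "t \<le> y" for s t
      proof -
        have "\<bar>F t - F s\<bar> = norm (integral {s..t} f)"
          using F that by (auto simp: ac_deriv_def)
        also have "\<dots> \<le> integral {s..t} (\<lambda>t. \<bar>f t\<bar>)"
          using ac_deriv_has_integral[OF F] that absf
          by (intro integral_norm_bound_integral) (auto simp: has_integral_iff)
        also have "\<dots> \<le> integral {x..y} (\<lambda>t. \<bar>f t\<bar>)"
          using that absf by (intro integral_subset_le) auto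
        finally show ?thesis using \<Phi> by simp
      qed
      have dG: "\<bar>G t - G x\<bar> \<le> M * (y - x)" if "t \<in> {x..y}" for t
      proof -
        have "norm (G t - G x) \<le> M * measure lborel {x..t}"
          using that xy M ac_deriv_has_integral[OF G]
          by (intro has_integral_bound_real[of M "{}" g]) auto
        then have "\<bar>G t - G x\<bar> \<le> M * (t - x)"
          using that by simp
        also have "\<dots> \<le> M * (y - x)" using that M by (intro mult_left_mono) auto
        finally show ?thesis .
      qed
      have 1: "(?k has_integral (integral {a..y} ?k - integral {a..x} ?k)) {x..y}"
        using Henstock_Kurzweil_Integration.integral_combine[OF xy(1,2) kint] kint
        by (simp add: has_integral_iff)
      note 2 = has_integral_mult_right[OF ac_deriv_has_integral[OF F xy(2)], of "G x"]
      note 3 = has_integral_mult_right[OF ac_deriv_has_integral[OF G xy(2)], of "F y"]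
      \<comment> \<open>Freezing \<open>G\<close> at the left and \<open>F\<close> at the right endpoint reproduces \<open>F y * G y - F x * G x\<close> exactly.\<close>
      have I: "((\<lambda>t. ?k t - G x * f t - F y * g t) has_integral (H y - H x)) {x..y}"
        using has_integral_diff[OF has_integral_diff[OF 1 2] 3]
        by (simp add: H_def algebra_simps)
      have bnd: "\<bar>?k t - G x * f t - F y * g t\<bar> \<le> M * (y - x) * \<bar>f t\<bar> + M * (\<Phi> y - \<Phi> x)"
        if "t \<in> {x..y}" for t
      proof -
        have "?k t - G x * f t - F y * g t = (G t - G x) * f t - (F y - F t) * g t"
          by (simp add: algebra_simps)
        also have "\<bar>\<dots>\<bar> \<le> \<bar>G t - G x\<bar> * \<bar>f t\<bar> + \<bar>F y - F t\<bar> * \<bar>g t\<bar>"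
          by (metis abs_mult abs_triangle_ineq4)
        also have "\<dots> \<le> M * (y - x) * \<bar>f t\<bar> + (\<Phi> y - \<Phi> x) * M"
          using that dG[of t] dF[of t y] dF[of x x] M(2)[of t] xy M(1)
          by (intro add_mono mult_mono) auto
        finally show ?thesis by (simp add: mult.commute)
      qed
      have J: "((\<lambda>t. M * (y - x) * \<bar>f t\<bar> + M * (\<Phi> y - \<Phi> x)) has_integral
              (M * (y - x) * (\<Phi> y - \<Phi> x) + (y - x) *\<^sub>R (M * (\<Phi> y - \<Phi> x)))) {x..y}"
        using has_integral_const_real[of "M * (\<Phi> y - \<Phi> x)" x y] xy absf[of x y] \<Phi>
        by (intro has_integral_add has_integral_mult_right) (auto simp: has_integral_iff)
      have "norm (H y - H x) \<le> M * (y - x) * (\<Phi> y - \<Phi> x) + (y - x) *\<^sub>R (M * (\<Phi> y - \<Phi> x))"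
        unfolding integral_unique[OF I, symmetric] integral_unique[OF J, symmetric]
        using I J bnd by (intro integral_norm_bound_integral) (auto simp: has_integral_iff)
      moreover have "\<Phi> y - \<Phi> x \<ge> 0" using dF[of x x] xy by auto
      ultimately show ?thesis by (simp add: algebra_simps)
    qed
    have "(H has_field_derivative 0) (at x within {a..b})" if x: "x \<in> {a..b}" for x
      unfolding has_field_derivative_iff
    proof (rule Lim_null_comparison)
      have "continuous_on {a..b} \<Phi>"
        unfolding \<Phi>_def using absf by (intro indefinite_integral_continuous_1)
      then have "(\<Phi> \<longlongrightarrow> \<Phi> x) (at x within {a..b})"
        using x continuous_on_def by blast
      then have "((\<lambda>y. 2 * M * \<bar>\<Phi> y - \<Phi> x\<bar>) \<longlongrightarrow> 2 * M * \<bar>\<Phi> x - \<Phi> x\<bar>) (at x within {a..b})"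
        by (intro tendsto_intros)
      then show "((\<lambda>y. 2 * M * \<bar>\<Phi> y - \<Phi> x\<bar>) \<longlongrightarrow> 0) (at x within {a..b})" by simp
      have "norm ((H y - H x) / (y - x)) \<le> 2 * M * \<bar>\<Phi> y - \<Phi> x\<bar>" if "y \<in> {a..b}" "y \<noteq> x" for y
      proof (cases "x < y")
        case True
        then show ?thesis using key[of x y] x that by (simp add: divide_le_eq)
      next
        case False
        then show ?thesis using key[of y x] x that
          by (simp add: divide_le_eq abs_minus_commute)
      qed
      then show "\<forall>\<^sub>F y in at x within {a..b}. norm ((H y - H x) / (y - x)) \<le> 2 * M * \<bar>\<Phi> y - \<Phi> x\<bar>"
        by (auto simp: eventually_at_filter)
    qed
    then obtain c where "\<forall>x\<in>{a..b}. H x = c"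
      using has_field_derivative_zero_constant[of "{a..b}" H] by auto
    then have "H a = H b" using that by auto
    then show ?thesis by (simp add: H_def)
  qed
  then show ?thesis
    unfolding ac_deriv_def using k by simp
qed

definition primitive_from_0 :: "(real \<Rightarrow> real) \<Rightarrow> real \<Rightarrow> real" where
  "primitive_from_0 g x = (if 0 \<le> x then integral {0..x} g else - integral {x..0} g)"

lemma primitive_from_0_0 [simp]: "primitive_from_0 g 0 = 0"
  by (simp add: primitive_from_0_def)

lemma ac_deriv_primitive:
  assumes "\<And>a b. g absolutely_integrable_on {a..b}"
  shows "ac_deriv (primitive_from_0 g) g"
  unfolding ac_deriv_def
proof (intro allI impI conjI assms)
  fix a b :: real assume "a \<le> b"
  have i: "g integrable_on {a..b}" for a b
    using assms set_lebesgue_integral_eq_integral(1) by blast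
  show "primitive_from_0 g b - primitive_from_0 g a = integral {a..b} g"
    using \<open>a \<le> b\<close> Henstock_Kurzweil_Integration.integral_combine[OF _ _ i, of 0 a b]
      Henstock_Kurzweil_Integration.integral_combine[OF _ _ i, of a 0 b]
      Henstock_Kurzweil_Integration.integral_combine[OF _ _ i, of a b 0]
    by (auto simp: primitive_from_0_def)
qed

lemma L1_loc_iff: "g \<in> L1_loc \<longleftrightarrow> (\<forall>a b. g absolutely_integrable_on {a..b})"
proof
  assume "\<forall>a b. g absolutely_integrable_on {a..b}"
  then show "g \<in> L1_loc" unfolding L1_loc_def
  proof (intro CollectI allI impI)
    fix K :: "real set" assume g: "\<forall>a b. g absolutely_integrable_on {a..b}" and K: "compact K"
    then obtain a where "K \<subseteq> {-a..a}"
      by (metis bounded_subset_cbox_symmetric box_real(2) compact_imp_bounded)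
    then show "g absolutely_integrable_on K"
      using set_integrable_subset[of lebesgue "{-a..a}" g K] g lmeasurable_compact[OF K]
      by (auto simp: fmeasurableD)
  qed
qed (auto simp: L1_loc_def)

lemma L1_loc_abs_integrable: "g \<in> L1_loc \<Longrightarrow> g absolutely_integrable_on {a..b}"
  by (simp add: L1_loc_iff)

lemma ac_deriv_L1_loc:
  assumes "ac_deriv f g"
  shows "g \<in> L1_loc"
  using ac_deriv_abs_integrable[OF assms] by (simp add: L1_loc_iff)

lemma continuous_L1_loc:
  assumes "continuous_on UNIV f"
  shows "f \<in> L1_loc"
  unfolding L1_loc_iff
  using assms by (auto intro: absolutely_integrable_continuous_real continuous_on_subset)

text \<open>
By Lebesgue's differentiation theorem, almost every value of \<open>g\<close> is a limit of its averages over
intervals, and these averages are 0.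
\<close>

lemma AE_zero_if_integral_zero:
  fixes g :: "real \<Rightarrow> real"
  assumes "\<And>a b. (g has_integral 0) {a..b}"
  shows "AE x in lebesgue. g x = 0"
proof -
  have "g integrable_on cbox a b" for a b
    using assms by auto
  then obtain N where N: "negligible N" and
    *: "\<And>x e. x \<notin> N \<Longrightarrow> 0 < e \<Longrightarrow> \<exists>d>0. \<forall>h. 0 < h \<and> h < d \<longrightarrow>
          norm (integral (cbox x (x + h *\<^sub>R One)) g /\<^sub>R h ^ DIM(real) - g x) < e"
    using integrable_ccontinuous_explicit[of g] by metis
  have "g x = 0" if xN: "x \<notin> N" for x
  proof (rule ccontr)
    assume "g x \<noteq> 0"
    then obtain d where "d > 0" and d: "\<And>h. 0 < h \<and> h < d \<Longrightarrow>
       norm (integral (cbox x (x + h *\<^sub>R One)) g /\<^sub>R h ^ DIM(real) - g x) < \<bar>g x\<bar>"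
      using *[OF xN, of "\<bar>g x\<bar>"] by (metis zero_less_abs_iff)
    have "integral (cbox x (x + (d/2) *\<^sub>R One)) g = 0"
      using assms by (simp add: integral_unique)
    then show False using d[of "d/2"] \<open>d > 0\<close> by (simp only: ) auto
  qed
  then have "{x \<in> space lebesgue. \<not> g x = 0} \<subseteq> N" by auto
  then show ?thesis using N by (intro AE_I'[of N]) (auto simp: negligible_iff_null_sets)
qed

lemma ac_deriv_unique:
  assumes "ac_deriv f g" "ac_deriv f h"
  shows "AE x in lebesgue. g x = h x"
proof -
  have "((\<lambda>x. g x - h x) has_integral 0) {a..b}" for a b
    using has_integral_diff[OF ac_deriv_has_integral[OF assms(1)] ac_deriv_has_integral[OF assms(2)], of a b]
    by (cases "a \<le> b") auto
  then have "AE x in lebesgue. g x - h x = 0" by (rule AE_zero_if_integral_zero)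
  then show ?thesis by simp
qed

section \<open>Smooth test functions\<close>

definition smooth :: "(real \<Rightarrow> real) \<Rightarrow> bool" where
  "smooth f \<longleftrightarrow> (\<forall>k. (deriv ^^ k) f differentiable_on UNIV)"

text \<open>
A class of functions that is closed under differentiation consists of smooth functions. Products,
affine substitutions and the flat functions below are all handled by naming a suitable class, which
avoids formulas for higher derivatives.
\<close>

lemma smooth_coinduct:
  assumes "X f"
    and step: "\<And>f. X f \<Longrightarrow> \<exists>f'. (\<forall>x. (f has_real_derivative f' x) (at x)) \<and> (X f' \<or> smooth f')"
  shows "smooth f"
proof -
  have "(deriv ^^ k) f differentiable_on UNIV" if "X f \<or> smooth f" for k f
    using that
  proof (induction k arbitrary: f)
    case 0
    then show ?case
    proof
      assume "X f"
      then obtain f' where "\<forall>x. (f has_real_derivative f' x) (at x)" using step by blast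
      then show ?thesis
        using real_differentiable_def
        by (metis differentiable_at_imp_differentiable_on funpow_0)
    next
      assume "smooth f"
      then show ?thesis unfolding smooth_def by blast
    qed
  next
    case (Suc k)
    show ?case
      using Suc.prems
    proof
      assume "X f"
      then obtain f' where f': "\<forall>x. (f has_real_derivative f' x) (at x)" "X f' \<or> smooth f'"
        using step by blast
      then have "deriv f = f'" by (intro ext DERIV_imp_deriv) auto
      then show ?thesis using Suc.IH[OF f'(2)] by (simp add: funpow_Suc_right del: funpow.simps)
    next
      assume "smooth f"
      then show ?thesis unfolding smooth_def by blast
    qed
  qed
  then show ?thesis using assms(1) by (simp add: smooth_def)
qed

lemma smooth_has_derivative:
  assumes "smooth f"
  shows "(f has_real_derivative deriv f x) (at x)"
proof -
  have "f differentiable_on UNIV" using assms unfolding smooth_def by (metis funpow_0)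
  then show ?thesis
    by (simp add: DERIV_deriv_iff_real_differentiable differentiable_on_def)
qed

lemma smooth_deriv:
  assumes "smooth f"
  shows "smooth (deriv f)"
  unfolding smooth_def
proof
  fix k
  have "(deriv ^^ Suc k) f differentiable_on UNIV" using assms unfolding smooth_def by blast
  then show "(deriv ^^ k) (deriv f) differentiable_on UNIV"
    by (simp add: funpow_Suc_right del: funpow.simps)
qed

lemma smooth_antiderivative:
  assumes "\<And>x. (F has_real_derivative f x) (at x)" "smooth f"
  shows "smooth F"
  by (rule smooth_coinduct[where X = "\<lambda>g. g = F"]) (use assms in auto)

lemma smooth_continuous: "smooth f \<Longrightarrow> continuous_on UNIV f"
  using smooth_has_derivative by (meson DERIV_continuous_on has_field_derivative_at_within)

lemma smooth_linear_combination:
  assumes "smooth f" "smooth g"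
  shows "smooth (\<lambda>x. a * f x + b * g x)"
proof (rule smooth_coinduct[where X = "\<lambda>h. \<exists>f g. smooth f \<and> smooth g \<and> h = (\<lambda>x. a * f x + b * g x)"])
  show "\<exists>f' g'. smooth f' \<and> smooth g' \<and> (\<lambda>x. a * f x + b * g x) = (\<lambda>x. a * f' x + b * g' x)"
    using assms by blast
  fix h assume "\<exists>f g. smooth f \<and> smooth g \<and> h = (\<lambda>x. a * f x + b * g x)"
  then obtain f g where fg: "smooth f" "smooth g" and h: "h = (\<lambda>x. a * f x + b * g x)" by blast
  have "(h has_real_derivative a * deriv f x + b * deriv g x) (at x)" for x
    unfolding h by (intro DERIV_add DERIV_cmult smooth_has_derivative fg)
  then show "\<exists>h'. (\<forall>x. (h has_real_derivative h' x) (at x)) \<and>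
      ((\<exists>f g. smooth f \<and> smooth g \<and> h' = (\<lambda>x. a * f x + b * g x)) \<or> smooth h')"
    using smooth_deriv fg by (intro exI[of _ "\<lambda>x. a * deriv f x + b * deriv g x"]) blast
qed

lemma smooth_affine_compose:
  assumes "smooth f"
  shows "smooth (\<lambda>x. f (m * x + p))"
proof (rule smooth_coinduct[where X = "\<lambda>h. \<exists>f c. smooth f \<and> h = (\<lambda>x. c * f (m * x + p))"])
  show "\<exists>g c. smooth g \<and> (\<lambda>x. f (m * x + p)) = (\<lambda>x. c * g (m * x + p))"
    using assms by (intro exI[of _ f] exI[of _ 1]) auto
  fix h assume "\<exists>f c. smooth f \<and> h = (\<lambda>x. c * f (m * x + p))"
  then obtain f c where f: "smooth f" and h: "h = (\<lambda>x. c * f (m * x + p))" by blast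
  have "(h has_real_derivative (c * m) * deriv f (m * x + p)) (at x)" for x
    unfolding h
    by (rule derivative_eq_intros DERIV_chain2[OF smooth_has_derivative[OF f]] refl | simp)+
  then show "\<exists>h'. (\<forall>x. (h has_real_derivative h' x) (at x)) \<and>
      ((\<exists>f c. smooth f \<and> h' = (\<lambda>x. c * f (m * x + p))) \<or> smooth h')"
    using smooth_deriv f by (intro exI[of _ "\<lambda>x. (c * m) * deriv f (m * x + p)"]) blast
qed

text \<open>
Products of smooth functions are not closed under differentiation, but finite sums of them are.
\<close>

inductive sum_of_smooth_products :: "(real \<Rightarrow> real) \<Rightarrow> bool" where
  product: "smooth f \<Longrightarrow> smooth g \<Longrightarrow> sum_of_smooth_products (\<lambda>x. f x * g x)"
| sum: "sum_of_smooth_products f \<Longrightarrow> sum_of_smooth_products g \<Longrightarrow>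
        sum_of_smooth_products (\<lambda>x. f x + g x)"

lemma smooth_mult:
  assumes "smooth f" "smooth g"
  shows "smooth (\<lambda>x. f x * g x)"
proof (rule smooth_coinduct[where X = sum_of_smooth_products])
  show "sum_of_smooth_products (\<lambda>x. f x * g x)" using assms by (rule product)
  fix h assume "sum_of_smooth_products h"
  then have "\<exists>h'. (\<forall>x. (h has_real_derivative h' x) (at x)) \<and> sum_of_smooth_products h'"
  proof induction
    case (product f g)
    have "((\<lambda>x. f x * g x) has_real_derivative deriv f x * g x + deriv g x * f x) (at x)" for x
      by (intro DERIV_mult smooth_has_derivative product)
    moreover have "sum_of_smooth_products (\<lambda>x. deriv f x * g x + deriv g x * f x)"
      by (intro sum_of_smooth_products.intros smooth_deriv product)
    ultimately show ?case by (intro exI conjI allI)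
  next
    case (sum f g)
    then obtain f' g' where "\<forall>x. (f has_real_derivative f' x) (at x)" "sum_of_smooth_products f'"
      "\<forall>x. (g has_real_derivative g' x) (at x)" "sum_of_smooth_products g'" by blast
    then show ?case
      by (intro exI[of _ "\<lambda>x. f' x + g' x"]) (auto intro: DERIV_add sum_of_smooth_products.sum)
  qed
  then show "\<exists>h'. (\<forall>x. (h has_real_derivative h' x) (at x)) \<and> (sum_of_smooth_products h' \<or> smooth h')"
    by blast
qed

text \<open>
The functions \<open>p(1/x) e^(-1/x)\<close>, extended by 0 to the left half line, for polynomials \<open>p\<close>. They
contain the classical smooth function \<open>e^(-1/x)\<close> and are closed under differentiation.
\<close>

definition flat :: "real poly \<Rightarrow> real \<Rightarrow> real" where
  "flat p x = (if 0 < x then poly p (inverse x) * exp (- inverse x) else 0)"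

lemma poly_times_exp_neg_tendsto_0:
  fixes p :: "real poly"
  shows "((\<lambda>y. poly p y * exp (- y)) \<longlongrightarrow> 0) at_top"
proof -
  have "((\<lambda>y. \<Sum>i\<le>degree p. coeff p i * (y ^ i / exp y)) \<longlongrightarrow> (\<Sum>i\<le>degree p. coeff p i * 0)) at_top"
    by (intro tendsto_intros tendsto_power_div_exp_0)
  moreover have "(\<Sum>i\<le>degree p. coeff p i * (y ^ i / exp y)) = poly p y * exp (- y)" for y
    by (simp add: poly_altdef sum_divide_distrib sum_distrib_right exp_minus divide_inverse mult.assoc)
  ultimately show ?thesis by simp
qed

text \<open>
At the origin the difference quotient from the right is again of the form \<open>q(y) e^(-y)\<close> with
\<open>y = 1/x\<close> and \<open>q(y) = y p(y)\<close>, which tends to 0 as \<open>y\<close> tends to infinity.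
\<close>

lemma flat_has_derivative:
  "(flat p has_real_derivative flat ([:0, 0, 1:] * (p - pderiv p)) x) (at x)"
proof -
  consider "x < 0" | "x > 0" | "x = 0" by linarith
  then show ?thesis
  proof cases
    case 1
    have "((\<lambda>x. 0) has_real_derivative 0) (at x)" by simp
    then have "(flat p has_real_derivative 0) (at x)"
      by (rule has_field_derivative_transform_within_open[of _ _ _ "{..<0}"])
        (use 1 in \<open>auto simp: flat_def\<close>)
    then show ?thesis using 1 by (simp add: flat_def)
  next
    case 2
    have "((\<lambda>x. poly p (inverse x) * exp (- inverse x)) has_real_derivative
        flat ([:0, 0, 1:] * (p - pderiv p)) x) (at x)"
      using 2
      by (auto intro!: derivative_eq_intros DERIV_chain2[OF poly_DERIV]
          simp: flat_def field_simps power2_eq_square)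
    then show ?thesis
      by (rule has_field_derivative_transform_within_open[of _ _ _ "{0<..}"])
        (use 2 in \<open>auto simp: flat_def\<close>)
  next
    case 3
    have "((\<lambda>h. poly (pCons 0 p) (inverse h) * exp (- inverse h)) \<longlongrightarrow> 0) (at_right 0)"
      using filterlim_compose[OF poly_times_exp_neg_tendsto_0 filterlim_inverse_at_top_right] .
    then have R: "((\<lambda>h. (flat p h - flat p 0) / (h - 0)) \<longlongrightarrow> 0) (at_right 0)"
      by (rule Lim_transform_eventually)
        (auto simp: eventually_at_filter flat_def field_simps)
    have "((\<lambda>h::real. 0::real) \<longlongrightarrow> 0) (at_left 0)" by simp
    then have "((\<lambda>h. (flat p h - flat p 0) / (h - 0)) \<longlongrightarrow> 0) (at_left 0)"
      by (rule Lim_transform_eventually) (auto simp: eventually_at_filter flat_def)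
    then show ?thesis
      using R 3 by (simp add: has_field_derivative_iff filterlim_split_at flat_def)
  qed
qed

lemma smooth_flat: "smooth (flat p)"
  by (rule smooth_coinduct[where X = "\<lambda>f. \<exists>p. f = flat p"]) (use flat_has_derivative in blast)+

lemma has_derivative_primitive:
  assumes "continuous_on UNIV g"
  shows "(primitive_from_0 g has_real_derivative g x) (at x)"
  using assms continuous_L1_loc[OF assms]
  by (intro ac_deriv_imp_has_real_derivative ac_deriv_primitive) (auto simp: L1_loc_iff)

text \<open>
Test functions whose first or second derivative is a prescribed combination of bumps are obtained
from antiderivatives of one bump \<open>\<rho>\<close>. To the right of its support the first antiderivative \<open>P\<close> is
constant and the second one \<open>Q\<close> is affine with slope 1, so suitable combinations of translates have
compact support.
\<close>

lemma mollifier_with_antiderivatives: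
  obtains \<rho> P Q :: "real \<Rightarrow> real" where
    "\<And>x. 0 \<le> \<rho> x" "\<And>x. 1 \<le> \<bar>x\<bar> \<Longrightarrow> \<rho> x = 0" "smooth \<rho>"
    "\<And>x. (P has_real_derivative \<rho> x) (at x)" "\<And>x. (Q has_real_derivative P x) (at x)"
    "\<And>x. x \<le> -1 \<Longrightarrow> P x = 0" "\<And>x. 1 \<le> x \<Longrightarrow> P x = 1"
    "\<And>x. x \<le> -1 \<Longrightarrow> Q x = 0" "\<And>x. 1 \<le> x \<Longrightarrow> Q x = Q 1 + (x - 1)"
proof -
  define \<beta> where "\<beta> x = flat 1 (1 * x + 1) * flat 1 ((-1) * x + 1)" for x
  have s\<beta>: "smooth \<beta>"
    unfolding \<beta>_def by (intro smooth_mult smooth_affine_compose smooth_flat)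
  have \<beta>0: "\<beta> x = 0" if "1 \<le> \<bar>x\<bar>" for x using that by (auto simp: \<beta>_def flat_def)
  have \<beta>pos: "\<beta> x \<ge> 0" for x by (auto simp: \<beta>_def flat_def)
  note cb = smooth_continuous[OF s\<beta>]
  have ib: "(\<beta> has_integral integral {-1..1} \<beta>) {-1..1}"
    by (intro integrable_integral integrable_continuous_real continuous_on_subset[OF cb]) auto
  define c where "c = integral {-1..1} \<beta>"
  have "c \<noteq> 0"
  proof
    assume "c = 0"
    then have "\<beta> 0 = 0"
      using has_integral_0_cbox_imp_0[of "-1" 1 \<beta> 0] ib \<beta>pos cb
      by (auto simp: c_def box_real intro: continuous_on_subset)
    then show False by (simp add: \<beta>_def flat_def)
  qed
  moreover have "c \<ge> 0" unfolding c_def using ib \<beta>pos by (intro integral_nonneg) auto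
  ultimately have c: "c > 0" by simp
  define \<rho> where "\<rho> x = (1 / c) * \<beta> x + 0 * \<beta> x" for x
  have s\<rho>: "smooth \<rho>" unfolding \<rho>_def by (intro smooth_linear_combination s\<beta>)
  have \<rho>0: "\<rho> x = 0" if "1 \<le> \<bar>x\<bar>" for x using \<beta>0[OF that] by (simp add: \<rho>_def)
  define P where "P x = primitive_from_0 \<rho> x - primitive_from_0 \<rho> (-1)" for x
  have P': "(P has_real_derivative \<rho> x) (at x)" for x
    unfolding P_def
    using DERIV_diff[OF has_derivative_primitive[OF smooth_continuous[OF s\<rho>]] DERIV_const] by simp
  have acP: "ac_deriv P \<rho>"
    by (rule ac_deriv_of_continuous_derivative[OF P' smooth_continuous[OF s\<rho>]])
  have "(\<rho> has_integral (1 / c) * c) {-1..1}"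
    using has_integral_mult_right[OF ib, of "1/c"] unfolding \<rho>_def[abs_def] c_def by simp
  from has_integral_unique[OF this ac_deriv_has_integral[OF acP]]
  have P1: "P 1 = 1"
    using c by (simp add: P_def)
  have Pm: "P x = 0" if "x \<le> -1" for x
  proof -
    have "P x \<le> P (-1)" "P (-1) \<le> P x"
      using that \<rho>0 ac_deriv_mono[OF acP, of x "-1"] ac_deriv_antimono[OF acP, of x "-1"] by auto
    then show ?thesis by (simp add: P_def)
  qed
  have Pp: "P x = 1" if "1 \<le> x" for x
  proof -
    have "P 1 \<le> P x" "P x \<le> P 1"
      using that \<rho>0 ac_deriv_mono[OF acP, of 1 x] ac_deriv_antimono[OF acP, of 1 x] by auto
    then show ?thesis using P1 by simp
  qed
  define Q where "Q x = primitive_from_0 P x - primitive_from_0 P (-1)" for x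
  have Q': "(Q has_real_derivative P x) (at x)" for x
    unfolding Q_def
    using DERIV_diff[OF has_derivative_primitive[OF ac_deriv_continuous[OF acP]] DERIV_const] by simp
  have acQ: "ac_deriv Q P"
    by (rule ac_deriv_of_continuous_derivative[OF Q' ac_deriv_continuous[OF acP]])
  have Qm: "Q x = 0" if "x \<le> -1" for x
  proof -
    have "Q x \<le> Q (-1)" "Q (-1) \<le> Q x"
      using that Pm ac_deriv_mono[OF acQ, of x "-1"] ac_deriv_antimono[OF acQ, of x "-1"] by auto
    then show ?thesis by (simp add: Q_def)
  qed
  have Qp: "Q x = Q 1 + (x - 1)" if "1 \<le> x" for x
  proof -
    have ac: "ac_deriv (\<lambda>x. Q x - x) (\<lambda>x. P x - 1)"
      by (intro ac_deriv_diff acQ ac_deriv_of_continuous_derivative) (auto intro!: continuous_intros)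
    have "Q 1 - 1 \<le> Q x - x" "Q x - x \<le> Q 1 - 1"
      using that Pp ac_deriv_mono[OF ac, of 1 x] ac_deriv_antimono[OF ac, of 1 x] by auto
    then show ?thesis by simp
  qed
  have "0 \<le> \<rho> x" for x using \<beta>pos c by (simp add: \<rho>_def)
  then show thesis using that[of \<rho> P Q] \<rho>0 s\<rho> P' Q' Pm Pp Qm Qp by blast
qed

section \<open>Weak derivatives as indefinite integrals\<close>

lemma
  fixes k :: "real \<Rightarrow> real"
  assumes "k absolutely_integrable_on {a..b}" "\<And>x. x \<notin> {a..b} \<Longrightarrow> k x = 0"
  shows integrable_of_bounded_support: "integrable lebesgue k"
    and lebesgue_integral_of_bounded_support: "(LINT x|lebesgue. k x) = integral {a..b} k"
proof -
  have eq: "(\<lambda>x. indicator {a..b} x *\<^sub>R k x) = k"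
  proof
    fix x
    show "indicator {a..b} x *\<^sub>R k x = k x"
      using assms(2)[of x] by (cases "x \<in> {a..b}") (simp_all del: atLeastAtMost_iff)
  qed
  show "integrable lebesgue k"
    using assms(1) unfolding set_integrable_def eq .
  show "(LINT x|lebesgue. k x) = integral {a..b} k"
    using set_lebesgue_integral_eq_integral(2)[OF assms(1)] unfolding set_lebesgue_integral_def eq .
qed

lemma ac_deriv_integral_by_parts:
  assumes f: "ac_deriv f g" and \<psi>: "\<And>x. (\<psi> has_real_derivative \<psi>' x) (at x)"
    and c: "continuous_on UNIV \<psi>'" and supp: "\<And>x. R < \<bar>x\<bar> \<Longrightarrow> \<psi> x = 0"
  shows "(LINT x|lebesgue. f x * \<psi>' x) = - (LINT x|lebesgue. g x * \<psi> x)"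
proof -
  define S where "S = \<bar>R\<bar> + 1"
  have supp': "\<psi>' x = 0" if "R < \<bar>x\<bar>" for x
  proof -
    have "((\<lambda>x. 0) has_real_derivative 0) (at x)" by simp
    then have "(\<psi> has_real_derivative 0) (at x)"
      by (rule has_field_derivative_transform_within_open[of _ _ _ "{x. R < \<bar>x\<bar>}"])
        (use that supp in \<open>auto intro!: open_Collect_less continuous_intros\<close>)
    then show ?thesis using \<psi> DERIV_unique by blast
  qed
  have out: "R < \<bar>x\<bar>" if "x \<notin> {-S..S}" for x using that by (auto simp: S_def)
  have ac\<psi>: "ac_deriv \<psi> \<psi>'" by (rule ac_deriv_of_continuous_derivative[OF \<psi> c])
  have "bounded (\<psi>' ` {a..b})" for a b
    by (rule bounded_image_Icc_of_continuous[OF c])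
  note ac = ac_deriv_mult[OF f ac\<psi> this]
  have 1: "(\<lambda>x. f x * \<psi>' x) absolutely_integrable_on {-S..S}"
    by (intro abs_integrable_continuous_mult ac_deriv_continuous[OF f] ac_deriv_abs_integrable[OF ac\<psi>])
  have 2: "(\<lambda>x. g x * \<psi> x) absolutely_integrable_on {-S..S}"
    using abs_integrable_continuous_mult[OF ac_deriv_continuous[OF ac\<psi>] ac_deriv_abs_integrable[OF f]]
    by (simp add: mult.commute)
  have total: "((\<lambda>x. g x * \<psi> x + f x * \<psi>' x) has_integral f S * \<psi> S - f (-S) * \<psi> (-S)) {-S..S}"
    by (rule ac_deriv_has_integral[OF ac]) (simp add: S_def)
  have "\<psi> S = 0" "\<psi> (-S) = 0" using supp by (auto simp: S_def)
  moreover have "((\<lambda>x. g x * \<psi> x + f x * \<psi>' x) has_integral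
       integral {-S..S} (\<lambda>x. g x * \<psi> x) + integral {-S..S} (\<lambda>x. f x * \<psi>' x)) {-S..S}"
    using 1 2 set_lebesgue_integral_eq_integral(1)
    by (intro has_integral_add integrable_integral) auto
  from has_integral_unique[OF this total]
  have "integral {-S..S} (\<lambda>x. g x * \<psi> x) + integral {-S..S} (\<lambda>x. f x * \<psi>' x)
      = f S * \<psi> S - f (-S) * \<psi> (-S)" .
  ultimately have "integral {-S..S} (\<lambda>x. g x * \<psi> x) + integral {-S..S} (\<lambda>x. f x * \<psi>' x) = 0"
    by simp
  then show ?thesis
    using lebesgue_integral_of_bounded_support[OF 1] lebesgue_integral_of_bounded_support[OF 2]
      out supp supp' by auto
qed

lemma test_function_smooth: "test_function \<psi> \<Longrightarrow> smooth \<psi>"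
  by (simp add: test_function_def smooth_def)

lemma test_function_support:
  assumes "test_function \<psi>"
  obtains R where "\<And>x. R < \<bar>x\<bar> \<Longrightarrow> \<psi> x = 0"
proof -
  have "bounded {x. \<psi> x \<noteq> 0}"
    using assms unfolding test_function_def
    by (meson bounded_subset closure_subset compact_imp_bounded)
  then obtain R where "\<And>x. \<psi> x \<noteq> 0 \<Longrightarrow> \<bar>x\<bar> \<le> R"
    by (auto simp: bounded_iff)
  then show thesis using that[of R] by fastforce
qed

lemma test_functionI:
  assumes "smooth \<psi>" "\<And>x. R < \<bar>x\<bar> \<Longrightarrow> \<psi> x = 0"
  shows "test_function \<psi>"
proof -
  have "\<bar>x\<bar> \<le> R" if "\<psi> x \<noteq> 0" for x
    using that assms(2)[of x] by fastforce
  then have "bounded {x. \<psi> x \<noteq> 0}" by (auto simp: bounded_iff)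
  then show ?thesis using assms(1) by (simp add: test_function_def smooth_def)
qed

lemma test_function_deriv:
  assumes "test_function \<psi>"
  shows "test_function (deriv \<psi>)"
proof -
  note s = test_function_smooth[OF assms]
  obtain R where R: "\<And>x. R < \<bar>x\<bar> \<Longrightarrow> \<psi> x = 0" using test_function_support[OF assms] by blast
  show ?thesis
  proof (rule test_functionI[OF smooth_deriv[OF s]])
    fix x :: real assume "R < \<bar>x\<bar>"
    have "((\<lambda>x. 0) has_real_derivative 0) (at x)" by simp
    then have "(\<psi> has_real_derivative 0) (at x)"
      by (rule has_field_derivative_transform_within_open[of _ _ _ "{x. R < \<bar>x\<bar>}"])
        (use \<open>R < \<bar>x\<bar>\<close> R in \<open>auto intro!: open_Collect_less continuous_intros\<close>)
    then show "deriv \<psi> x = 0" by (rule DERIV_imp_deriv)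
  qed
qed

lemma ac_deriv_integral_test_function:
  assumes "ac_deriv f g" "test_function \<psi>"
  shows "(LINT x|lebesgue. f x * deriv \<psi> x) = - (LINT x|lebesgue. g x * \<psi> x)"
proof -
  obtain R where "\<And>x. R < \<bar>x\<bar> \<Longrightarrow> \<psi> x = 0" using test_function_support[OF assms(2)] by blast
  then show ?thesis
    using test_function_smooth[OF assms(2)] smooth_has_derivative smooth_deriv smooth_continuous
    by (intro ac_deriv_integral_by_parts[OF assms(1)]) auto
qed

lemma integrable_mult_test_function:
  assumes "f \<in> L1_loc" "test_function \<psi>"
  shows "integrable lebesgue (\<lambda>x. f x * \<psi> x)"
proof -
  obtain R where R: "\<And>x. R < \<bar>x\<bar> \<Longrightarrow> \<psi> x = 0" using test_function_support[OF assms(2)] by blast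
  have "(\<lambda>x. \<psi> x * f x) absolutely_integrable_on {-R..R}"
    by (intro abs_integrable_continuous_mult smooth_continuous test_function_smooth
        L1_loc_abs_integrable assms)
  then have "(\<lambda>x. f x * \<psi> x) absolutely_integrable_on {-R..R}" by (simp add: mult.commute)
  then show ?thesis using R by (intro integrable_of_bounded_support[where a = "-R" and b = R]) auto
qed

text \<open>
The rescaled bumps have integral 1, as the increment of the antiderivative \<open>P\<close> shows, and they
concentrate at \<open>p\<close>, where \<open>d\<close> is continuous.
\<close>

lemma mollified_tendsto:
  fixes d \<rho> P :: "real \<Rightarrow> real"
  assumes d: "continuous_on UNIV d"
    and \<rho>: "\<And>x. 0 \<le> \<rho> x" "\<And>x. 1 \<le> \<bar>x\<bar> \<Longrightarrow> \<rho> x = 0" "continuous_on UNIV \<rho>"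
    and P: "\<And>x. (P has_real_derivative \<rho> x) (at x)" "P (-1) = 0" "P 1 = 1"
  shows "((\<lambda>\<epsilon>. LINT x|lebesgue. d x * (\<rho> ((x - p) / \<epsilon>) / \<epsilon>)) \<longlongrightarrow> d p) (at_right 0)"
proof (rule tendstoI)
  fix e :: real assume "e > 0"
  have "isCont d p" using d by (simp add: continuous_on_eq_continuous_at)
  then obtain \<delta> where "\<delta> > 0" and \<delta>: "\<And>x. \<bar>x - p\<bar> < \<delta> \<Longrightarrow> \<bar>d x - d p\<bar> < e / 2"
    using \<open>e > 0\<close> unfolding continuous_at_eps_delta dist_real_def by (metis half_gt_zero)
  have "dist (LINT x|lebesgue. d x * (\<rho> ((x - p) / \<epsilon>) / \<epsilon>)) (d p) < e" if \<epsilon>: "0 < \<epsilon>" "\<epsilon> < \<delta>" for \<epsilon>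
  proof -
    let ?\<rho> = "\<lambda>x. \<rho> ((x - p) / \<epsilon>) / \<epsilon>"
    have c\<rho>: "continuous_on UNIV ?\<rho>"
      using \<epsilon> by (intro continuous_intros continuous_on_compose2[OF \<rho>(3)]) auto
    have "((\<lambda>x. (x - p) / \<epsilon>) has_real_derivative 1 / \<epsilon>) (at x)" for x
      using \<epsilon> by (auto intro!: derivative_eq_intros)
    from DERIV_chain2[OF P(1) this]
    have "((\<lambda>x. P ((x - p) / \<epsilon>)) has_real_derivative ?\<rho> x) (at x)" for x
      by simp
    then have acP: "ac_deriv (\<lambda>x. P ((x - p) / \<epsilon>)) ?\<rho>"
      by (rule ac_deriv_of_continuous_derivative[OF _ c\<rho>])
    have I: "(?\<rho> has_integral 1) {p-\<epsilon>..p+\<epsilon>}"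
      using ac_deriv_has_integral[OF acP, of "p-\<epsilon>" "p+\<epsilon>"] \<epsilon> P(2,3) by simp
    have cd: "continuous_on {p-\<epsilon>..p+\<epsilon>} (\<lambda>x. d x * ?\<rho> x)"
      by (intro continuous_intros continuous_on_subset[OF d] continuous_on_subset[OF c\<rho>]) (use \<epsilon> in auto)
    have L: "(LINT x|lebesgue. d x * ?\<rho> x) = integral {p-\<epsilon>..p+\<epsilon>} (\<lambda>x. d x * ?\<rho> x)"
    proof (rule lebesgue_integral_of_bounded_support)
      show "(\<lambda>x. d x * ?\<rho> x) absolutely_integrable_on {p-\<epsilon>..p+\<epsilon>}"
        by (rule absolutely_integrable_continuous_real[OF cd])
      fix x assume "x \<notin> {p-\<epsilon>..p+\<epsilon>}"
      then have "1 \<le> \<bar>(x - p) / \<epsilon>\<bar>" using \<epsilon> by (auto simp: abs_if field_simps)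
      then show "d x * ?\<rho> x = 0" using \<rho>(2) by simp
    qed
    have J: "((\<lambda>x. d x * ?\<rho> x) has_integral integral {p-\<epsilon>..p+\<epsilon>} (\<lambda>x. d x * ?\<rho> x)) {p-\<epsilon>..p+\<epsilon>}"
      by (intro integrable_integral integrable_continuous_real cd)
    have nn: "0 \<le> ?\<rho> x" for x using \<rho>(1) \<epsilon> by simp
    note up = has_integral_mult_right[OF I, of "d p + e/2"]
    note lo = has_integral_mult_right[OF I, of "d p - e/2"]
    have in\<delta>: "\<bar>d x - d p\<bar> < e/2" if "x \<in> {p-\<epsilon>..p+\<epsilon>}" for x using that \<epsilon> by (intro \<delta>) auto
    have "integral {p-\<epsilon>..p+\<epsilon>} (\<lambda>x. d x * ?\<rho> x) \<le> (d p + e/2) * 1"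
    proof (rule has_integral_le[OF J up])
      fix x assume "x \<in> {p-\<epsilon>..p+\<epsilon>}"
      from in\<delta>[OF this] show "d x * ?\<rho> x \<le> (d p + e/2) * ?\<rho> x"
        by (intro mult_right_mono nn) linarith
    qed
    moreover have "(d p - e/2) * 1 \<le> integral {p-\<epsilon>..p+\<epsilon>} (\<lambda>x. d x * ?\<rho> x)"
    proof (rule has_integral_le[OF lo J])
      fix x assume "x \<in> {p-\<epsilon>..p+\<epsilon>}"
      from in\<delta>[OF this] show "(d p - e/2) * ?\<rho> x \<le> d x * ?\<rho> x"
        by (intro mult_right_mono nn) linarith
    qed
    moreover have "\<bar>I - d p\<bar> < e" if "I \<le> (d p + e/2) * 1" "(d p - e/2) * 1 \<le> I" for I
      using that \<open>e > 0\<close> by simp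
    ultimately show ?thesis unfolding L dist_real_def by blast
  qed
  then show "\<forall>\<^sub>F \<epsilon> in at_right 0. dist (LINT x|lebesgue. d x * (\<rho> ((x - p) / \<epsilon>) / \<epsilon>)) (d p) < e"
    using \<open>\<delta> > 0\<close> by (auto simp: eventually_at_right_field)
qed

text \<open>
If the \<open>k\<close>-th weak derivative of a continuous \<open>d\<close> is 0, then \<open>d\<close> satisfies every relation between
its values at three points that is satisfied by all constants (for \<open>k = 1\<close>) or by all affine
functions (for \<open>k = 2\<close>). The combination of bumps at the points \<open>p1\<close>, \<open>p2\<close>, \<open>p3\<close> with
coefficients \<open>c1\<close>, \<open>c2\<close>, \<open>c3\<close> is the \<open>k\<close>-th derivative of the same combination of \<open>P\<close> or
\<open>Q\<close>. The conditions on the coefficients say precisely that this antiderivative vanishes to the right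
of all bumps, and hence is a test function. Shrinking the bumps gives the relation.
\<close>

lemma du_Bois_Reymond_three_points:
  assumes d: "continuous_on UNIV d"
    and vanish: "\<And>\<psi>. test_function \<psi> \<Longrightarrow> (LINT x|lebesgue. d x * (deriv ^^ k) \<psi> x) = 0"
    and k: "k = 1 \<or> k = 2 \<and> c1 * p1 + c2 * p2 + c3 * p3 = 0"
    and c: "c1 + c2 + c3 = 0"
  shows "c1 * d p1 + c2 * d p2 + c3 * d p3 = 0"
proof -
  obtain \<rho> P Q :: "real \<Rightarrow> real" where
    \<rho>: "\<And>x. 0 \<le> \<rho> x" "\<And>x. 1 \<le> \<bar>x\<bar> \<Longrightarrow> \<rho> x = 0" "smooth \<rho>" and
    P': "\<And>x. (P has_real_derivative \<rho> x) (at x)" and Q': "\<And>x. (Q has_real_derivative P x) (at x)" and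
    P: "\<And>x. x \<le> -1 \<Longrightarrow> P x = 0" "\<And>x. 1 \<le> x \<Longrightarrow> P x = 1" and
    Q: "\<And>x. x \<le> -1 \<Longrightarrow> Q x = 0" "\<And>x. 1 \<le> x \<Longrightarrow> Q x = Q 1 + (x - 1)"
    using mollifier_with_antiderivatives by blast
  have sP: "smooth P" by (rule smooth_antiderivative[OF P' \<rho>(3)])
  have sQ: "smooth Q" by (rule smooth_antiderivative[OF Q' sP])
  define comb where "comb F \<epsilon> x = c1 * F ((x - p1) / \<epsilon>) + c2 * F ((x - p2) / \<epsilon>) + c3 * F ((x - p3) / \<epsilon>)"
    for F :: "real \<Rightarrow> real" and \<epsilon> x
  have smooth_comb: "smooth (comb F \<epsilon>)" if "smooth F" for F \<epsilon>
  proof -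
    have *: "smooth (\<lambda>x. F ((x - p) / \<epsilon>))" for p
      using smooth_affine_compose[OF that, of "1/\<epsilon>" "-p/\<epsilon>"] by (simp add: diff_divide_distrib)
    show ?thesis
      unfolding comb_def[abs_def]
      using smooth_linear_combination[OF smooth_linear_combination[OF * *, of c1 p1 c2 p2] *, of 1 c3 p3]
      by simp
  qed
  have deriv_comb: "((\<lambda>x. a * comb F \<epsilon> x) has_real_derivative (a / \<epsilon>) * comb f \<epsilon> x) (at x)"
    if "\<epsilon> > 0" "\<And>x. (F has_real_derivative f x) (at x)" for F f \<epsilon> a x
  proof -
    have "((\<lambda>x. (x - p) / \<epsilon>) has_real_derivative 1 / \<epsilon>) (at x)" for x p
      using \<open>\<epsilon> > 0\<close> by (auto intro!: derivative_eq_intros)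
    from DERIV_chain2[OF that(2) this]
    have *: "((\<lambda>x. F ((x - p) / \<epsilon>)) has_real_derivative f ((x - p) / \<epsilon>) * (1 / \<epsilon>)) (at x)" for x p .
    have "((\<lambda>x. a * comb F \<epsilon> x) has_real_derivative
        a * (c1 * (f ((x - p1) / \<epsilon>) * (1 / \<epsilon>)) + c2 * (f ((x - p2) / \<epsilon>) * (1 / \<epsilon>))
          + c3 * (f ((x - p3) / \<epsilon>) * (1 / \<epsilon>)))) (at x)"
      unfolding comb_def by (intro DERIV_add DERIV_cmult *)
    then show ?thesis by (simp add: comb_def algebra_simps add_divide_distrib)
  qed
  let ?A = "\<lambda>p \<epsilon>. LINT x|lebesgue. d x * (\<rho> ((x - p) / \<epsilon>) / \<epsilon>)"
  have zero: "c1 * ?A p1 \<epsilon> + c2 * ?A p2 \<epsilon> + c3 * ?A p3 \<epsilon> = 0" if \<epsilon>: "\<epsilon> > 0" for \<epsilon>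
  proof -
    define R where "R = max \<bar>p1\<bar> (max \<bar>p2\<bar> \<bar>p3\<bar>) + \<epsilon>"
    have out: "(x - p) / \<epsilon> \<le> -1 \<and> x < 0 \<or> 1 \<le> (x - p) / \<epsilon> \<and> x > 0"
      if "R < \<bar>x\<bar>" "p \<in> {p1, p2, p3}" for x p
      using that \<epsilon> by (auto simp: R_def field_simps abs_if max_def split: if_splits)
    have suppP: "comb P \<epsilon> x = 0" if "R < \<bar>x\<bar>" for x
      using out[OF that, of p1] out[OF that, of p2] out[OF that, of p3] P c
      by (auto simp: comb_def)
    define \<psi> where "\<psi> = (if k = 1 then comb P \<epsilon> else (\<lambda>x. \<epsilon> * comb Q \<epsilon> x))"
    have "test_function \<psi>"
    proof (rule test_functionI[where R = R])
      show "smooth \<psi>"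
        using smooth_comb[OF sP] smooth_linear_combination[OF smooth_comb[OF sQ] smooth_comb[OF sQ], of \<epsilon> _ 0]
        by (auto simp: \<psi>_def)
      fix x assume x: "R < \<bar>x\<bar>"
      show "\<psi> x = 0"
      proof (cases "k = 1")
        case True
        then show ?thesis using suppP[OF x] by (simp add: \<psi>_def)
      next
        case False
        then have m: "c1 * p1 + c2 * p2 + c3 * p3 = 0" using k by auto
        have "comb Q \<epsilon> x = 0"
        proof (cases "x < 0")
          case True
          then show ?thesis
            using out[OF x, of p1] out[OF x, of p2] out[OF x, of p3] Q(1) by (auto simp: comb_def)
        next
          case False
          then have "comb Q \<epsilon> x = c1 * (Q 1 + ((x - p1) / \<epsilon> - 1)) + c2 * (Q 1 + ((x - p2) / \<epsilon> - 1))
              + c3 * (Q 1 + ((x - p3) / \<epsilon> - 1))"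
            using out[OF x, of p1] out[OF x, of p2] out[OF x, of p3]
              Q(2)[of "(x - p1) / \<epsilon>"] Q(2)[of "(x - p2) / \<epsilon>"] Q(2)[of "(x - p3) / \<epsilon>"]
            by (auto simp: comb_def)
          also have "\<dots> = (c1 + c2 + c3) * (Q 1 + x / \<epsilon> - 1) - (c1 * p1 + c2 * p2 + c3 * p3) / \<epsilon>"
            by (simp add: algebra_simps add_divide_distrib diff_divide_distrib)
          finally show ?thesis using c m by simp
        qed
        then show ?thesis using False by (simp add: \<psi>_def)
      qed
    qed
    from vanish[OF this] have v: "(LINT x|lebesgue. d x * (deriv ^^ k) \<psi> x) = 0" .
    have \<psi>k: "(deriv ^^ k) \<psi> = (\<lambda>x. (1 / \<epsilon>) * comb \<rho> \<epsilon> x)"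
    proof (cases "k = 1")
      case True
      have "deriv (comb P \<epsilon>) x = (1 / \<epsilon>) * comb \<rho> \<epsilon> x" for x
        using deriv_comb[OF \<epsilon> P', of 1] by (intro DERIV_imp_deriv) simp
      then show ?thesis using True by (auto simp: \<psi>_def)
    next
      case False
      then have "k = Suc (Suc 0)" using k by auto
      have "deriv (\<lambda>x. \<epsilon> * comb Q \<epsilon> x) = comb P \<epsilon>"
        using deriv_comb[OF \<epsilon> Q', of \<epsilon>] \<epsilon> by (intro ext DERIV_imp_deriv) simp
      moreover have "deriv (comb P \<epsilon>) x = (1 / \<epsilon>) * comb \<rho> \<epsilon> x" for x
        using deriv_comb[OF \<epsilon> P', of 1] by (intro DERIV_imp_deriv) simp
      ultimately show ?thesis using False \<open>k = Suc (Suc 0)\<close> by (auto simp: \<psi>_def)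
    qed
    have "(LINT x|lebesgue. d x * ((1 / \<epsilon>) * comb \<rho> \<epsilon> x)) = c1 * ?A p1 \<epsilon> + c2 * ?A p2 \<epsilon> + c3 * ?A p3 \<epsilon>"
    proof -
      have "test_function (\<lambda>x. \<rho> ((x - p) / \<epsilon>) / \<epsilon>)" for p
      proof (rule test_functionI[where R = "\<bar>p\<bar> + \<epsilon>"])
        show "smooth (\<lambda>x. \<rho> ((x - p) / \<epsilon>) / \<epsilon>)"
          using smooth_linear_combination[OF smooth_affine_compose[OF \<rho>(3)] \<rho>(3), of "1/\<epsilon>" "1/\<epsilon>" "-p/\<epsilon>" 0]
          by (simp add: diff_divide_distrib)
        fix x assume "\<bar>p\<bar> + \<epsilon> < \<bar>x\<bar>"
        then have "1 \<le> \<bar>(x - p) / \<epsilon>\<bar>" using \<epsilon> by (auto simp: abs_if field_simps split: if_splits)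
        then show "\<rho> ((x - p) / \<epsilon>) / \<epsilon> = 0" using \<rho>(2) by simp
      qed
      then have i: "integrable lebesgue (\<lambda>x. d x * (\<rho> ((x - p) / \<epsilon>) / \<epsilon>))" for p
        by (intro integrable_mult_test_function continuous_L1_loc d)
      have "(LINT x|lebesgue. d x * ((1 / \<epsilon>) * comb \<rho> \<epsilon> x)) =
          (LINT x|lebesgue. c1 * (d x * (\<rho> ((x - p1) / \<epsilon>) / \<epsilon>)) + c2 * (d x * (\<rho> ((x - p2) / \<epsilon>) / \<epsilon>))
              + c3 * (d x * (\<rho> ((x - p3) / \<epsilon>) / \<epsilon>)))"
        by (intro Bochner_Integration.integral_cong) (auto simp: comb_def algebra_simps add_divide_distrib)
      also have "\<dots> = c1 * ?A p1 \<epsilon> + c2 * ?A p2 \<epsilon> + c3 * ?A p3 \<epsilon>"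
        using i by (simp only: Bochner_Integration.integral_add integrable_mult_right
            Bochner_Integration.integrable_add integral_mult_right_zero)
      finally show ?thesis .
    qed
    then show ?thesis using v unfolding \<psi>k by metis
  qed
  have lim: "((\<lambda>\<epsilon>. ?A p \<epsilon>) \<longlongrightarrow> d p) (at_right 0)" for p
    by (rule mollified_tendsto[OF d \<rho>(1,2) smooth_continuous[OF \<rho>(3)] P']) (auto intro: P)
  have "((\<lambda>\<epsilon>. c1 * ?A p1 \<epsilon> + c2 * ?A p2 \<epsilon> + c3 * ?A p3 \<epsilon>) \<longlongrightarrow> c1 * d p1 + c2 * d p2 + c3 * d p3) (at_right 0)"
    by (intro tendsto_intros lim)
  moreover have "((\<lambda>\<epsilon>. c1 * ?A p1 \<epsilon> + c2 * ?A p2 \<epsilon> + c3 * ?A p3 \<epsilon>) \<longlongrightarrow> 0) (at_right 0)"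
    using zero by (intro tendsto_eventually eventually_mono[OF eventually_at_right_less])
  ultimately show ?thesis by (rule tendsto_unique[rotated]) simp
qed

text \<open>
The difference between \<open>f\<close> and an indefinite integral of \<open>g\<close> has weak derivative 0, and comparing
its values at \<open>x\<close> and \<open>0\<close> shows that it is constant. The converse is integration by parts.
\<close>

theorem has_weak_deriv_1_iff:
  assumes f: "continuous_on UNIV f"
  shows "has_weak_deriv 1 f g \<longleftrightarrow> ac_deriv f g"
proof
  assume "ac_deriv f g"
  then show "has_weak_deriv 1 f g"
    using continuous_L1_loc[OF f] ac_deriv_L1_loc ac_deriv_integral_test_function
    by (simp add: has_weak_deriv_def)
next
  assume w: "has_weak_deriv 1 f g"
  define G where "G = primitive_from_0 g"
  have acG: "ac_deriv G g"
    unfolding G_def using w by (intro ac_deriv_primitive) (auto simp: has_weak_deriv_def L1_loc_iff)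
  note cG = ac_deriv_continuous[OF acG]
  have cd: "continuous_on UNIV (\<lambda>x. f x - G x)" by (intro continuous_intros f cG)
  have "f x - G x = f 0 - G 0" for x
  proof -
    have "1 * (f x - G x) + (-1) * (f 0 - G 0) + 0 * (f 0 - G 0) = 0"
    proof (rule du_Bois_Reymond_three_points[OF cd, where k = 1])
      fix \<psi> assume \<psi>: "test_function \<psi>"
      have "(LINT x|lebesgue. (f x - G x) * deriv \<psi> x) =
          (LINT x|lebesgue. f x * deriv \<psi> x) - (LINT x|lebesgue. G x * deriv \<psi> x)"
        unfolding left_diff_distrib
        by (intro Bochner_Integration.integral_diff integrable_mult_test_function
            test_function_deriv \<psi> continuous_L1_loc f cG)
      also have "\<dots> = 0"
        using w ac_deriv_integral_test_function[OF acG \<psi>] \<psi> by (simp add: has_weak_deriv_def)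
      finally show "(LINT x|lebesgue. (f x - G x) * (deriv ^^ 1) \<psi> x) = 0" by simp
    qed auto
    then show ?thesis by simp
  qed
  then have "f = (\<lambda>x. G x + (f 0 - G 0))" by (intro ext) (simp add: algebra_simps)
  moreover have "ac_deriv (\<lambda>x. G x + (f 0 - G 0)) g"
    using ac_deriv_add[OF acG ac_deriv_const] by simp
  ultimately show "ac_deriv f g" by metis
qed

text \<open>
As for the first derivative, with an iterated integral of \<open>g\<close>. The three-point relation at \<open>x\<close>,
\<open>0\<close>, \<open>1\<close> with coefficients \<open>1\<close>, \<open>x - 1\<close>, \<open>- x\<close> says that the difference is affine.
\<close>

theorem has_weak_deriv_2_iff:
  assumes f: "continuous_on UNIV f"
  shows "has_weak_deriv 2 f g \<longleftrightarrow> (\<exists>f'. ac_deriv f f' \<and> ac_deriv f' g)"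
proof
  have funpow_2: "(deriv ^^ 2) \<psi> = deriv (deriv \<psi>)" for \<psi> :: "real \<Rightarrow> real"
    by (simp add: numeral_2_eq_2)
  have twice: "(LINT x|lebesgue. f x * deriv (deriv \<psi>) x) = (LINT x|lebesgue. g x * \<psi> x)"
    if "ac_deriv f f'" "ac_deriv f' g" "test_function \<psi>" for f f' g \<psi>
    using ac_deriv_integral_test_function[OF that(1) test_function_deriv[OF that(3)]]
      ac_deriv_integral_test_function[OF that(2,3)] by simp
  {
    assume "\<exists>f'. ac_deriv f f' \<and> ac_deriv f' g"
    then show "has_weak_deriv 2 f g"
      using continuous_L1_loc[OF f] ac_deriv_L1_loc twice
      by (auto simp: has_weak_deriv_def funpow_2)
  next
    assume w: "has_weak_deriv 2 f g"
    define G where "G = primitive_from_0 g"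
    define W where "W = primitive_from_0 G"
    have acG: "ac_deriv G g"
      unfolding G_def using w by (intro ac_deriv_primitive) (auto simp: has_weak_deriv_def L1_loc_iff)
    have acW: "ac_deriv W G"
      unfolding W_def using continuous_L1_loc[OF ac_deriv_continuous[OF acG]]
      by (intro ac_deriv_primitive) (simp add: L1_loc_iff)
    note cW = ac_deriv_continuous[OF acW]
    have cd: "continuous_on UNIV (\<lambda>x. f x - W x)" by (intro continuous_intros f cW)
    define m where "m = (f 1 - W 1) - (f 0 - W 0)"
    have "f x - W x = f 0 - W 0 + m * x" for x
    proof -
      have "1 * (f x - W x) + (x - 1) * (f 0 - W 0) + (- x) * (f 1 - W 1) = 0"
      proof (rule du_Bois_Reymond_three_points[OF cd, where k = 2])
        fix \<psi> assume \<psi>: "test_function \<psi>"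
        have "(LINT x|lebesgue. (f x - W x) * deriv (deriv \<psi>) x) =
            (LINT x|lebesgue. f x * deriv (deriv \<psi>) x) - (LINT x|lebesgue. W x * deriv (deriv \<psi>) x)"
          unfolding left_diff_distrib
          by (intro Bochner_Integration.integral_diff integrable_mult_test_function
              test_function_deriv \<psi> continuous_L1_loc f cW)
        also have "\<dots> = 0"
          using w twice[OF acW acG \<psi>] \<psi> by (simp add: has_weak_deriv_def funpow_2)
        finally show "(LINT x|lebesgue. (f x - W x) * (deriv ^^ 2) \<psi> x) = 0" by (simp add: funpow_2)
      qed auto
      then show ?thesis by (simp add: m_def algebra_simps)
    qed
    then have eq: "f = (\<lambda>x. W x + (f 0 - W 0 + m * x))" by (intro ext) (simp add: algebra_simps)
    have "ac_deriv (\<lambda>x. f 0 - W 0 + m * x) (\<lambda>x. m)"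
      by (rule ac_deriv_of_continuous_derivative) (auto intro!: derivative_eq_intros)
    then have "ac_deriv f (\<lambda>x. G x + m)"
      by (subst eq) (intro ac_deriv_add acW)
    moreover have "ac_deriv (\<lambda>x. G x + m) g"
      using ac_deriv_add[OF acG ac_deriv_const] by simp
    ultimately show "\<exists>f'. ac_deriv f f' \<and> ac_deriv f' g" by blast
  }
qed

lemma has_weak_deriv_weak_deriv:
  "has_weak_deriv k f g \<Longrightarrow> has_weak_deriv k f (weak_deriv k f)"
  unfolding weak_deriv_def using someI[of "has_weak_deriv k f" g] by simp

lemma weak_deriv_1_AE:
  assumes "ac_deriv f g"
  shows "ac_deriv f (weak_deriv 1 f)" "AE x in lebesgue. weak_deriv 1 f x = g x"
proof -
  note c = ac_deriv_continuous[OF assms]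
  show "ac_deriv f (weak_deriv 1 f)"
    using assms has_weak_deriv_weak_deriv unfolding has_weak_deriv_1_iff[OF c, symmetric] by blast
  then show "AE x in lebesgue. weak_deriv 1 f x = g x"
    using ac_deriv_unique assms by blast
qed

lemma weak_deriv_2_AE:
  assumes "ac_deriv f f'" "ac_deriv f' g"
  shows "AE x in lebesgue. weak_deriv 2 f x = g x"
proof -
  note c = ac_deriv_continuous[OF assms(1)]
  have "has_weak_deriv 2 f (weak_deriv 2 f)"
    using has_weak_deriv_weak_deriv[of 2 f g] has_weak_deriv_2_iff[OF c] assms by blast
  then obtain h where h: "ac_deriv f h" "ac_deriv h (weak_deriv 2 f)"
    using has_weak_deriv_2_iff[OF c] by blast
  have "h x = f' x" for x
    using DERIV_unique ac_deriv_imp_has_real_derivative ac_deriv_continuous h assms by blast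
  then have "h = f'" by auto
  then show ?thesis using ac_deriv_unique h(2) assms(2) by blast
qed

section \<open>The initial value problem\<close>

text \<open>
Carrying the continuous derivative \<open>u'\<close> along turns \<open>u'' = V u\<close> into a first order system, and
every later argument works with the pair.
\<close>

definition solves :: "(real \<Rightarrow> real) \<Rightarrow> (real \<Rightarrow> real) \<Rightarrow> (real \<Rightarrow> real) \<Rightarrow> bool" where
  "solves V u u' \<longleftrightarrow> ac_deriv u u' \<and> ac_deriv u' (\<lambda>x. V x * u x)"

lemma solves_linear_combination:
  assumes "solves V u u'" "solves V w w'"
  shows "solves V (\<lambda>x. a * u x + b * w x) (\<lambda>x. a * u' x + b * w' x)"
proof -
  have "ac_deriv (\<lambda>x. a * u' x + b * w' x) (\<lambda>x. a * (V x * u x) + b * (V x * w x))"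
    using assms unfolding solves_def by (intro ac_deriv_add ac_deriv_cmul) auto
  moreover have "(\<lambda>x. a * (V x * u x) + b * (V x * w x)) = (\<lambda>x. V x * (a * u x + b * w x))"
    by (auto simp: algebra_simps)
  ultimately show ?thesis
    using assms unfolding solves_def by (auto intro!: ac_deriv_add ac_deriv_cmul)
qed

lemma solves_reflect:
  assumes "solves V u u'"
  shows "solves (\<lambda>x. V (- x)) (\<lambda>x. u (- x)) (\<lambda>x. - u' (- x))"
  using assms ac_deriv_reflect[of u u'] ac_deriv_cmul[OF ac_deriv_reflect[of u' "\<lambda>x. V x * u x"], of "-1"]
  by (simp add: solves_def)

lemma solves_continuous:
  assumes "solves V u u'"
  shows "continuous_on UNIV u" "continuous_on UNIV u'"
  using assms ac_deriv_continuous unfolding solves_def by blast+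

lemma solves_has_derivative:
  assumes "solves V u u'"
  shows "(u has_real_derivative u' x) (at x)"
  using assms ac_deriv_imp_has_real_derivative solves_continuous(2) unfolding solves_def by blast

text \<open>
The integrating factor behind all the comparison arguments below: the sign of \<open>f + c F\<close> decides
whether \<open>e^(c x) F\<close> is monotone.
\<close>

lemma ac_deriv_exp_mult:
  assumes "ac_deriv F f"
  shows "ac_deriv (\<lambda>x. exp (c * x) * F x) (\<lambda>x. exp (c * x) * (f x + c * F x))"
proof -
  have "ac_deriv (\<lambda>x. exp (c * x)) (\<lambda>x. c * exp (c * x))"
    by (rule ac_deriv_of_continuous_derivative)
      (auto intro!: derivative_eq_intros continuous_intros)
  moreover have "bounded ((\<lambda>x. c * exp (c * x)) ` {a..b})" for a b
    by (intro bounded_image_Icc_of_continuous continuous_intros)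
  ultimately have "ac_deriv (\<lambda>x. F x * exp (c * x))
      (\<lambda>x. f x * exp (c * x) + F x * (c * exp (c * x)))"
    by (rule ac_deriv_mult[OF assms])
  moreover have "(\<lambda>x. f x * exp (c * x) + F x * (c * exp (c * x))) = (\<lambda>x. exp (c * x) * (f x + c * F x))"
    by (auto simp: algebra_simps)
  ultimately show ?thesis by (simp add: mult.commute)
qed

lemma primitive_from_0_diff:
  assumes "\<And>a b. g absolutely_integrable_on {a..b}" "\<And>a b. h absolutely_integrable_on {a..b}"
  shows "primitive_from_0 (\<lambda>t. g t - h t) x = primitive_from_0 g x - primitive_from_0 h x"
proof -
  have "g integrable_on {a..b}" "h integrable_on {a..b}" for a b
    using assms set_lebesgue_integral_eq_integral(1) by blast+
  then show ?thesis
    by (simp add: primitive_from_0_def Henstock_Kurzweil_Integration.integral_diff)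
qed

text \<open>
Integration divides an exponential weight by its rate. Applied twice, this makes the Volterra operator
of the initial value problem a contraction once \<open>M\<^sup>2 > v1\<close>.
\<close>

lemma primitive_from_0_exp_bound:
  assumes g: "\<And>a b. g absolutely_integrable_on {a..b}"
    and M: "0 < M" and C: "0 \<le> C" and bnd: "\<And>t. \<bar>g t\<bar> \<le> C * exp (M * \<bar>t\<bar>)"
  shows "\<bar>primitive_from_0 g x\<bar> \<le> C / M * exp (M * \<bar>x\<bar>)"
proof -
  have i: "g integrable_on {a..b}" for a b
    using g set_lebesgue_integral_eq_integral(1) by blast
  \<comment> \<open>The sign \<open>s\<close> treats the half lines to the right (\<open>s = 1\<close>) and to the left (\<open>s = -1\<close>) of 0 together.\<close>
  have step: "\<bar>integral {a..b} g\<bar> \<le> C / M * exp (M * \<bar>x\<bar>)"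
    if s: "s * s = 1" and ab: "a \<le> b" "s * (exp (M * (s * b)) - exp (M * (s * a))) \<le> exp (M * \<bar>x\<bar>)"
      and sgn: "\<And>t. t \<in> {a..b} \<Longrightarrow> \<bar>t\<bar> = s * t" for s a b :: real
  proof -
    have "((\<lambda>t. C / M * s * exp (M * (s * t))) has_real_derivative C * exp (M * (s * t))) (at t)" for t
      using s M by (auto intro!: derivative_eq_intros)
    then have "ac_deriv (\<lambda>t. C / M * s * exp (M * (s * t))) (\<lambda>t. C * exp (M * (s * t)))"
      by (rule ac_deriv_of_continuous_derivative) (auto intro!: continuous_intros)
    from ac_deriv_has_integral[OF this ab(1)]
    have e: "((\<lambda>t. C * exp (M * (s * t))) has_integral
        C / M * s * exp (M * (s * b)) - C / M * s * exp (M * (s * a))) {a..b}" .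
    have "norm (integral {a..b} g) \<le> integral {a..b} (\<lambda>t. C * exp (M * (s * t)))"
      using e bnd sgn by (intro integral_norm_bound_integral i) (auto simp: has_integral_iff, metis)
    also have "\<dots> = C / M * (s * (exp (M * (s * b)) - exp (M * (s * a))))"
      using integral_unique[OF e] by (simp add: algebra_simps)
    also have "\<dots> \<le> C / M * exp (M * \<bar>x\<bar>)"
      using ab(2) M C by (intro mult_left_mono) auto
    finally show ?thesis by simp
  qed
  show ?thesis
  proof (cases "0 \<le> x")
    case True
    then show ?thesis using step[of 1 0 x] by (simp add: primitive_from_0_def)
  next
    case False
    then show ?thesis using step[of "-1" x 0] by (simp add: primitive_from_0_def)
  qed
qed

locale potential =
  fixes V :: "real \<Rightarrow> real" and v0 v1 :: real
  assumes V_measurable: "V \<in> borel_measurable lebesgue"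
    and v0_pos: "0 < v0"
    and V_lower: "\<And>x. v0 \<le> V x"
    and V_upper: "\<And>x. V x \<le> v1"
begin

lemma v0_le_v1: "v0 \<le> v1"
  using V_lower V_upper order_trans by blast

lemma V_pos: "0 < V x"
  using V_lower v0_pos less_le_trans by blast

lemma abs_integrable_V_mult:
  assumes "continuous_on UNIV u"
  shows "(\<lambda>x. V x * u x) absolutely_integrable_on {a..b}"
proof (rule absolutely_integrable_bounded_measurable_product_real)
  show "V \<in> borel_measurable (lebesgue_on {a..b})"
    by (rule measurable_restrict_space1[OF V_measurable])
  show "bounded (V ` {a..b})"
    using V_lower V_upper by (auto intro!: bounded_subset[OF bounded_closed_interval[of v0 v1]])
  show "u absolutely_integrable_on {a..b}"
    by (intro absolutely_integrable_continuous_real continuous_on_subset[OF assms]) auto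
qed auto

lemma bounded_V_mult:
  assumes "continuous_on UNIV u"
  shows "bounded ((\<lambda>x. V x * u x) ` {a..b})"
proof -
  obtain B where B: "\<And>x. x \<in> {a..b} \<Longrightarrow> \<bar>u x\<bar> \<le> B"
    using bounded_image_Icc_of_continuous[OF assms, of a b]
    unfolding bounded_iff ball_simps real_norm_def by blast
  have "norm (V x * u x) \<le> v1 * B" if "x \<in> {a..b}" for x
    using B[OF that] V_upper[of x] V_pos[of x] by (auto simp: abs_mult intro!: mult_mono)
  then show ?thesis by (intro boundedI[where B = "v1 * B"]) auto
qed

lemma reflected_potential: "potential (\<lambda>x. V (- x)) v0 v1"
proof
  have "(\<lambda>x. V (- x)) = V \<circ> (\<lambda>x. (-1) *\<^sub>R x)" by auto
  also have "\<dots> \<in> borel_measurable lebesgue"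
    by (rule measurable_comp[OF lebesgue_measurable_scaling V_measurable])
  finally show "(\<lambda>x. V (- x)) \<in> borel_measurable lebesgue" .
qed (use v0_pos V_lower V_upper in auto)

text \<open>
Write \<open>u = E w\<close> with the weight \<open>E = e^(M \<bar>x\<bar>)\<close> and a bounded continuous \<open>w\<close>. The equation
\<open>u = \<alpha> + \<beta> x + \<integral>\<integral> V u\<close> then becomes a fixed point equation for \<open>w\<close> on the whole line at once,
whose Lipschitz constant is \<open>v1 / M\<^sup>2\<close>; the choice \<open>M\<^sup>2 = 2 v1\<close> makes it \<open>1/2\<close>.
\<close>

lemma initial_value_problem:
  obtains u u' where "solves V u u'" "u 0 = \<alpha>" "u' 0 = \<beta>"
proof -
  define M where "M = sqrt (2 * v1)"
  have v1: "v1 > 0" using v0_pos v0_le_v1 by simp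
  have M: "M > 0" "v1 / (M * M) = 1 / 2" using v1 by (auto simp: M_def)
  define E where "E x = exp (M * \<bar>x\<bar>)" for x
  have Epos: "E x > 0" for x by (simp add: E_def)
  have cE: "continuous_on UNIV E" unfolding E_def by (intro continuous_intros)
  define G where "G w = primitive_from_0 (\<lambda>t. V t * (E t * w t))" for w :: "real \<Rightarrow> real"
  define J where "J w = primitive_from_0 (G w)" for w :: "real \<Rightarrow> real"
  have ai: "(\<lambda>t. V t * (E t * w t)) absolutely_integrable_on {a..b}" if "continuous_on UNIV w" for w a b
    by (intro abs_integrable_V_mult continuous_intros cE that)
  have acG: "ac_deriv (G w) (\<lambda>t. V t * (E t * w t))" if "continuous_on UNIV w" for w
    unfolding G_def by (intro ac_deriv_primitive ai that)
  have acJ: "ac_deriv (J w) (G w)" if "continuous_on UNIV w" for w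
    unfolding J_def
    using continuous_L1_loc[OF ac_deriv_continuous[OF acG[OF that]]]
    by (intro ac_deriv_primitive) (simp add: L1_loc_iff)
  have Jbnd: "\<bar>J w x\<bar> \<le> C / 2 * E x" if w: "continuous_on UNIV w" "\<And>t. \<bar>w t\<bar> \<le> C" for w C x
  proof -
    have C: "0 \<le> C" using w(2)[of 0] by linarith
    have 1: "\<bar>G w x\<bar> \<le> v1 * C / M * exp (M * \<bar>x\<bar>)" for x
      unfolding G_def
    proof (rule primitive_from_0_exp_bound[OF ai[OF w(1)] M(1)])
      fix t
      have "\<bar>V t * (E t * w t)\<bar> = V t * (E t * \<bar>w t\<bar>)"
        using V_pos[of t] Epos[of t] by (simp add: abs_mult)
      also have "\<dots> \<le> v1 * (E t * C)"
        using V_pos[of t] V_upper[of t] Epos[of t] w(2)[of t] v1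
        by (intro mult_mono) (auto intro: mult_nonneg_nonneg)
      finally show "\<bar>V t * (E t * w t)\<bar> \<le> v1 * C * exp (M * \<bar>t\<bar>)"
        by (simp add: E_def mult_ac)
    qed (use v1 C in auto)
    have "\<bar>J w x\<bar> \<le> v1 * C / M / M * exp (M * \<bar>x\<bar>)"
      unfolding J_def using v1 C M
      by (intro primitive_from_0_exp_bound 1 L1_loc_abs_integrable continuous_L1_loc
          ac_deriv_continuous[OF acG[OF w(1)]]) auto
    also have "v1 * C / M / M = C * (v1 / (M * M))" by simp
    also have "\<dots> = C / 2" unfolding M(2) by simp
    finally show ?thesis by (simp add: E_def)
  qed
  have Jdiff: "J w1 x - J w2 x = J (\<lambda>t. w1 t - w2 t) x"
    if w: "continuous_on UNIV w1" "continuous_on UNIV w2" for w1 w2 x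
  proof -
    have "G (\<lambda>t. w1 t - w2 t) = (\<lambda>x. G w1 x - G w2 x)"
      unfolding G_def using primitive_from_0_diff[OF ai[OF w(1)] ai[OF w(2)]]
      by (auto simp: algebra_simps)
    then show ?thesis
      unfolding J_def
      using primitive_from_0_diff[of "G w1" "G w2" x]
        L1_loc_abs_integrable[OF continuous_L1_loc[OF ac_deriv_continuous[OF acG[OF w(1)]]]]
        L1_loc_abs_integrable[OF continuous_L1_loc[OF ac_deriv_continuous[OF acG[OF w(2)]]]]
      by simp
  qed
  define S where "S w x = (\<alpha> + \<beta> * x + J w x) / E x" for w :: "real \<Rightarrow> real" and x
  have Sb: "S w \<in> bcontfun" if w: "continuous_on UNIV w" "\<And>t. \<bar>w t\<bar> \<le> C" for w C
  proof (rule bcontfun_normI)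
    have "continuous_on UNIV (\<lambda>x. (\<alpha> + \<beta> * x + J w x) / E x)"
      using Epos by (intro continuous_intros cE ac_deriv_continuous[OF acJ[OF w(1)]]) (metis less_irrefl)
    then show "continuous_on UNIV (S w)" by (simp add: S_def[abs_def])
    fix x
    have "0 \<le> M * \<bar>x\<bar>" using M by simp
    then have E1: "1 \<le> E x" and EM: "M * \<bar>x\<bar> \<le> E x"
      using exp_ge_add_one_self[of "M * \<bar>x\<bar>"] unfolding E_def by linarith+
    have "\<bar>\<alpha> + \<beta> * x + J w x\<bar> \<le> \<bar>\<alpha>\<bar> + \<bar>\<beta>\<bar> * \<bar>x\<bar> + \<bar>J w x\<bar>"
      using abs_triangle_ineq[of "\<alpha> + \<beta> * x" "J w x"] abs_triangle_ineq[of \<alpha> "\<beta> * x"]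
      by (simp add: abs_mult)
    also have "\<dots> \<le> \<bar>\<alpha>\<bar> * E x + \<bar>\<beta>\<bar> * (E x / M) + C / 2 * E x"
      using mult_left_mono[OF E1, of "\<bar>\<alpha>\<bar>"] EM M(1) Jbnd[OF w, of x]
      by (intro add_mono mult_left_mono) (auto simp: field_simps)
    also have "\<dots> = (\<bar>\<alpha>\<bar> + \<bar>\<beta>\<bar> / M + C / 2) * E x" by (simp add: algebra_simps)
    finally show "norm (S w x) \<le> \<bar>\<alpha>\<bar> + \<bar>\<beta>\<bar> / M + C / 2"
      using Epos[of x] by (simp add: S_def divide_le_eq)
  qed
  define T where "T w = Bcontfun (S (apply_bcontfun w))" for w :: "real \<Rightarrow>\<^sub>C real"
  have Tw: "apply_bcontfun (T w) = S (apply_bcontfun w)" for w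
  proof -
    obtain C where "\<And>x. norm (apply_bcontfun w x) \<le> C" using norm_bounded by blast
    then show ?thesis unfolding T_def by (intro Bcontfun_inverse Sb[of _ C]) auto
  qed
  have "dist (T w1) (T w2) \<le> 1 / 2 * dist w1 w2" for w1 w2
  proof (rule dist_bound)
    fix x
    have "dist (T w1 x) (T w2 x) = \<bar>J (\<lambda>t. w1 t - w2 t) x\<bar> / E x"
      using Epos[of x] Jdiff[of w1 w2 x]
      by (simp add: Tw S_def dist_real_def flip: diff_divide_distrib)
    also have "\<dots> \<le> 1 / 2 * dist w1 w2"
      using Jbnd[of "\<lambda>t. w1 t - w2 t" "dist w1 w2" x] dist_bounded[of w1 _ w2] Epos[of x]
      by (simp add: divide_le_eq continuous_intros dist_real_def)
    finally show "dist (T w1 x) (T w2 x) \<le> 1 / 2 * dist w1 w2" .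
  qed
  then obtain w where w: "T w = w"
    using banach_fix_type[of "1/2" T] by auto
  define u where "u x = E x * apply_bcontfun w x" for x
  have cw: "continuous_on UNIV (apply_bcontfun w)" by simp
  have ueq: "u x = (\<alpha> + \<beta> * x) + J w x" for x
  proof -
    have "apply_bcontfun w x = S (apply_bcontfun w) x" using Tw[of w] w by simp
    then show ?thesis using Epos[of x] by (simp add: u_def S_def)
  qed
  have "ac_deriv (\<lambda>x. \<alpha> + \<beta> * x) (\<lambda>x. \<beta>)"
    by (rule ac_deriv_of_continuous_derivative) (auto intro!: derivative_eq_intros)
  then have "ac_deriv u (\<lambda>x. \<beta> + G w x)"
    unfolding ueq[abs_def] by (intro ac_deriv_add acJ cw)
  moreover have "ac_deriv (\<lambda>x. \<beta> + G w x) (\<lambda>x. V x * u x)"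
    using ac_deriv_add[OF ac_deriv_const acG[OF cw]] by (simp add: u_def[abs_def])
  ultimately have "solves V u (\<lambda>x. \<beta> + G w x)" by (simp add: solves_def)
  moreover have "u 0 = \<alpha>" by (simp add: ueq J_def)
  ultimately show thesis using that by (simp add: G_def)
qed

section \<open>Decaying solutions\<close>

text \<open>
The derivative of \<open>u u'\<close> is nonnegative. This is the source of every qualitative statement about
solutions in this part.
\<close>

lemma solves_ac_deriv_product:
  assumes "solves V u u'"
  shows "ac_deriv (\<lambda>x. u x * u' x) (\<lambda>x. u' x * u' x + V x * (u x * u x))"
  using ac_deriv_mult[of u u' u' "\<lambda>x. V x * u x"] assms solves_continuous[OF assms] bounded_V_mult
  by (simp add: solves_def mult_ac)

lemma solves_product_mono:
  assumes "solves V u u'" "x \<le> y"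
  shows "u x * u' x \<le> u y * u' y"
  using ac_deriv_mono[OF solves_ac_deriv_product[OF assms(1)] assms(2)] V_pos
  by (simp add: less_imp_le)

lemma solves_square_has_derivative:
  assumes "solves V u u'"
  shows "((\<lambda>x. u x * u x) has_real_derivative 2 * (u x * u' x)) (at x)"
  by (rule derivative_eq_intros solves_has_derivative[OF assms] refl | simp)+

text \<open>
The energy \<open>u\<^sup>2 + u'\<^sup>2\<close> satisfies \<open>\<bar>\<E>'\<bar> \<le> (1 + v1) \<E>\<close>, so \<open>e^((1 + v1) x) \<E>\<close> is
nondecreasing and \<open>e^(- (1 + v1) x) \<E>\<close> is nonincreasing. A zero of the energy therefore spreads in
both directions.
\<close>

lemma solves_zero_of_initial_data:
  assumes s: "solves V u u'" and z: "u p = 0" "u' p = 0"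
  shows "u x = 0"
proof -
  define \<E> where "\<E> x = u x * u x + u' x * u' x" for x
  define \<D> where "\<D> x = 2 * (1 + V x) * (u x * u' x)" for x
  have "ac_deriv (\<lambda>x. u x * u x) (\<lambda>x. u' x * u x + u x * u' x)"
    using s solves_continuous[OF s]
    by (intro ac_deriv_mult bounded_image_Icc_of_continuous) (auto simp: solves_def)
  moreover have "ac_deriv (\<lambda>x. u' x * u' x) (\<lambda>x. V x * u x * u' x + u' x * (V x * u x))"
    using s solves_continuous[OF s]
    by (intro ac_deriv_mult bounded_V_mult) (auto simp: solves_def)
  ultimately have "ac_deriv \<E>
      (\<lambda>x. (u' x * u x + u x * u' x) + (V x * u x * u' x + u' x * (V x * u x)))"
    unfolding \<E>_def by (rule ac_deriv_add)
  moreover have "(\<lambda>x. (u' x * u x + u x * u' x) + (V x * u x * u' x + u' x * (V x * u x))) = \<D>"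
    by (auto simp: \<D>_def algebra_simps)
  ultimately have ac: "ac_deriv \<E> \<D>" by simp
  have \<E>nn: "\<E> x \<ge> 0" for x by (simp add: \<E>_def)
  have bound: "\<bar>\<D> x\<bar> \<le> (1 + v1) * \<E> x" for x
  proof -
    have "2 * \<bar>u x * u' x\<bar> \<le> \<E> x"
      using sum_squares_bound[of "\<bar>u x\<bar>" "\<bar>u' x\<bar>"]
      by (simp add: \<E>_def power2_eq_square abs_mult mult.assoc)
    then have "(1 + V x) * (2 * \<bar>u x * u' x\<bar>) \<le> (1 + v1) * \<E> x"
      using V_pos[of x] V_upper[of x] by (intro mult_mono) auto
    then show ?thesis using V_pos[of x] by (simp add: \<D>_def abs_mult mult_ac)
  qed
  have zero: "\<E> p = 0" by (simp add: \<E>_def z)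
  have "\<E> x = 0"
  proof (cases "x \<le> p")
    case True
    have "exp ((1 + v1) * x) * \<E> x \<le> exp ((1 + v1) * p) * \<E> p"
    proof (rule ac_deriv_mono[OF ac_deriv_exp_mult[OF ac] True])
      fix t
      have "0 \<le> \<D> t + (1 + v1) * \<E> t" using bound[of t] by linarith
      then show "0 \<le> exp ((1 + v1) * t) * (\<D> t + (1 + v1) * \<E> t)" by simp
    qed
    then show ?thesis using zero \<E>nn[of x] by (simp add: mult_le_0_iff)
  next
    case False
    have "exp (- (1 + v1) * x) * \<E> x \<le> exp (- (1 + v1) * p) * \<E> p"
    proof (rule ac_deriv_antimono[OF ac_deriv_exp_mult[OF ac]])
      fix t
      have "\<D> t + - (1 + v1) * \<E> t \<le> 0" using bound[of t] by linarith
      then show "exp (- (1 + v1) * t) * (\<D> t + - (1 + v1) * \<E> t) \<le> 0"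
        by (simp add: mult_le_0_iff)
    qed (use False in auto)
    then show ?thesis using zero \<E>nn[of x] by (simp add: mult_le_0_iff)
  qed
  then show ?thesis by (simp add: \<E>_def add_nonneg_eq_0_iff)
qed

text \<open>
The nondecreasing function \<open>u u'\<close> vanishes at both zeros, hence between them. There \<open>u\<^sup>2\<close> is
constant and equal to 0, so the initial data at an interior point are zero.
\<close>

lemma solves_zero_of_two_zeros:
  assumes s: "solves V u u'" and z: "u p = 0" "u q = 0" and "p < q"
  shows "u x = 0"
proof -
  have m: "u x * u' x = 0" if "x \<in> {p..q}" for x
    using solves_product_mono[OF s, of p x] solves_product_mono[OF s, of x q] that z by simp
  have "((\<lambda>x. u x * u x) has_field_derivative 0) (at x within {p..q})" if "x \<in> {p..q}" for x
    using solves_square_has_derivative[OF s, of x] m[OF that]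
    by (simp add: has_field_derivative_at_within)
  then obtain c where c: "\<And>x. x \<in> {p..q} \<Longrightarrow> u x * u x = c"
    using has_field_derivative_zero_constant[of "{p..q}" "\<lambda>x. u x * u x"] by auto
  then have "c = 0" using c[of p] z \<open>p < q\<close> by simp
  then have u0: "u x = 0" if "x \<in> {p..q}" for x using c[OF that] by simp
  define r where "r = (p + q) / 2"
  have r: "r \<in> {p<..<q}" using \<open>p < q\<close> by (simp add: r_def)
  have "((\<lambda>x. 0) has_real_derivative 0) (at r)" by simp
  then have "(u has_real_derivative 0) (at r)"
    by (rule has_field_derivative_transform_within_open[of _ _ _ "{p<..<q}"]) (use r u0 in auto)
  then have "u' r = 0" using solves_has_derivative[OF s] DERIV_unique by blast
  then show ?thesis using solves_zero_of_initial_data[OF s, of r] u0[of r] r by simp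
qed

lemma solves_square_antimono:
  assumes s: "solves V u u'" and "x \<le> y" and "u y * u' y \<le> 0"
  shows "u y * u y \<le> u x * u x"
proof (rule DERIV_nonpos_imp_nonincreasing[OF \<open>x \<le> y\<close>])
  fix t assume "x \<le> t" "t \<le> y"
  then have "2 * (u t * u' t) \<le> 0"
    using solves_product_mono[OF s, of t y] assms(3) by simp
  then show "\<exists>d. ((\<lambda>x. u x * u x) has_real_derivative d) (at t) \<and> d \<le> 0"
    using solves_square_has_derivative[OF s] by blast
qed

text \<open>
If \<open>u u'\<close> were positive at \<open>p\<close>, then it would stay at least as large to the right of \<open>p\<close>, and
\<open>u\<^sup>2\<close>, whose derivative is \<open>2 u u'\<close>, would grow at least linearly.
\<close>

lemma bounded_solution_product_nonpos:
  assumes s: "solves V u u'" and bnd: "\<And>x. a \<le> x \<Longrightarrow> u x * u x \<le> B"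
  shows "u p * u' p \<le> 0"
proof (rule ccontr)
  assume "\<not> ?thesis"
  then have m: "u p * u' p > 0" by simp
  \<comment> \<open>By this point linear growth has carried \<open>u\<^sup>2\<close> above its bound \<open>B\<close>.\<close>
  define x where "x = max a p + (B + 1) / (2 * (u p * u' p))"
  have "B \<ge> 0" using bnd[of a] zero_le_square[of "u a"] order_trans by blast
  then have x: "max a p \<le> x" using m by (simp add: x_def)
  have "(\<lambda>x. u x * u x - 2 * (u p * u' p) * x) (max a p) \<le> (\<lambda>x. u x * u x - 2 * (u p * u' p) * x) x"
  proof (rule DERIV_nonneg_imp_nondecreasing[OF x])
    fix t assume "max a p \<le> t" "t \<le> x"
    then have "0 \<le> 2 * (u t * u' t) - 2 * (u p * u' p)"
      using solves_product_mono[OF s, of p t] by simp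
    moreover have "((\<lambda>x. u x * u x - 2 * (u p * u' p) * x) has_real_derivative
        2 * (u t * u' t) - 2 * (u p * u' p)) (at t)"
      by (rule derivative_eq_intros solves_square_has_derivative[OF s] refl | simp)+
    ultimately show "\<exists>d. ((\<lambda>x. u x * u x - 2 * (u p * u' p) * x) has_real_derivative d) (at t) \<and> 0 \<le> d"
      by blast
  qed
  moreover have "2 * k * (max a p + (B + 1) / (2 * k)) = 2 * k * max a p + (B + 1)" if "k > 0" for k
    using that by (simp add: field_simps)
  then have "2 * (u p * u' p) * x = 2 * (u p * u' p) * max a p + (B + 1)"
    unfolding x_def using m by blast
  moreover have "u x * u x \<le> B" using bnd x by simp
  ultimately show False using zero_le_square[of "u (max a p)"] by linarith
qed

text \<open>
Since \<open>u\<^sup>2\<close> is nonincreasing, it suffices that it takes arbitrarily small values. Were it bounded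
below by \<open>e\<^sup>2\<close>, then \<open>(u u')' \<ge> v0 e\<^sup>2\<close> would eventually make \<open>u u'\<close> positive.
\<close>

lemma bounded_solution_decays:
  assumes s: "solves V u u'" and bnd: "\<And>x. a \<le> x \<Longrightarrow> u x * u x \<le> B"
  shows "(u \<longlongrightarrow> 0) at_top"
proof (rule tendstoI)
  fix e :: real assume "e > 0"
  have m: "u p * u' p \<le> 0" for p using s bnd by (rule bounded_solution_product_nonpos)
  have "\<exists>x. u x * u x < e * e"
  proof (rule ccontr)
    assume "\<not> ?thesis"
    then have big: "e * e \<le> u x * u x" for x by (simp add: not_less)
    define k where "k = v0 * (e * e)"
    have k: "k > 0" using v0_pos \<open>e > 0\<close> by (simp add: k_def)
    define x where "x = (1 - u 0 * u' 0) / k"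
    have x: "0 \<le> x" using k m[of 0] by (simp add: x_def divide_nonneg_pos)
    have "ac_deriv (\<lambda>x. k * x) (\<lambda>x. k)"
      by (rule ac_deriv_of_continuous_derivative) (auto intro!: derivative_eq_intros)
    note ac = ac_deriv_diff[OF solves_ac_deriv_product[OF s] this]
    have "u 0 * u' 0 - k * 0 \<le> u x * u' x - k * x"
    proof (rule ac_deriv_mono[OF ac x])
      fix t
      have "k \<le> V t * (u t * u t)"
        unfolding k_def using \<open>e > 0\<close>
        by (intro mult_mono[OF V_lower big]) (auto intro: less_imp_le[OF V_pos])
      then show "0 \<le> u' t * u' t + V t * (u t * u t) - k"
        using zero_le_square[of "u' t"] by linarith
    qed
    moreover have "k * x = 1 - u 0 * u' 0" using k by (simp add: x_def)
    ultimately show False using m[of x] by simp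
  qed
  then obtain p where p: "u p * u p < e * e" by blast
  have "dist (u x) 0 < e" if "p \<le> x" for x
  proof -
    have "u x * u x < e * e"
      using solves_square_antimono[OF s that m] p by linarith
    then have "\<bar>u x\<bar> < e"
      using \<open>e > 0\<close> abs_le_square_iff[of e "u x"] by (simp add: power2_eq_square not_le flip: not_less)
    then show ?thesis by simp
  qed
  then show "\<forall>\<^sub>F x in at_top. dist (u x) 0 < e"
    using eventually_at_top_linorder by blast
qed

lemma decaying_solution_product_nonpos:
  assumes s: "solves V u u'" and lim: "(u \<longlongrightarrow> 0) at_top"
  shows "u p * u' p \<le> 0"
proof -
  have "\<forall>\<^sub>F x in at_top. dist (u x) 0 < 1" using lim by (rule tendstoD) simp
  then obtain a where a: "\<And>x. a \<le> x \<Longrightarrow> \<bar>u x\<bar> < 1" by (auto simp: eventually_at_top_linorder)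
  have "u x * u x \<le> 1" if "a \<le> x" for x
    using a[OF that] by (metis abs_mult_self_eq abs_ge_zero less_imp_le mult_le_one)
  then show ?thesis by (rule bounded_solution_product_nonpos[OF s])
qed

text \<open>
To the right of a zero the nonincreasing function \<open>u\<^sup>2\<close> stays 0, which gives a second zero.
\<close>

lemma decaying_solution_zero:
  assumes s: "solves V u u'" and lim: "(u \<longlongrightarrow> 0) at_top" and z: "u p = 0"
  shows "u x = 0"
proof -
  have "u (p + 1) * u (p + 1) \<le> u p * u p"
    using decaying_solution_product_nonpos[OF s lim]
    by (intro solves_square_antimono[OF s]) auto
  then have "u (p + 1) = 0"
    using z zero_le_square[of "u (p + 1)"] by (simp add: antisym)
  then show ?thesis using solves_zero_of_two_zeros[OF s z, of "p + 1"] by simp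
qed

lemma decaying_solution_unique:
  assumes "solves V u u'" "(u \<longlongrightarrow> 0) at_top" "solves V w w'" "(w \<longlongrightarrow> 0) at_top" "u 0 = w 0"
  shows "u = w"
proof
  fix x
  have "((\<lambda>x. 1 * u x + (-1) * w x) \<longlongrightarrow> 1 * 0 + (-1) * 0) at_top"
    by (intro tendsto_intros assms(2,4))
  then have lim: "((\<lambda>x. 1 * u x + (-1) * w x) \<longlongrightarrow> 0) at_top" by simp
  have "1 * u x + (-1) * w x = 0"
    by (rule decaying_solution_zero[OF solves_linear_combination[OF assms(1,3)] lim, where p = 0])
      (simp add: assms(5))
  then show "u x = w x" by simp
qed

text \<open>
Shooting at zeros that move to infinity. With the fundamental solutions \<open>c\<close> and \<open>s\<close>, the solution
\<open>c + \<beta>\<^sub>n s\<close> has value 1 at 0 and vanishes at \<open>n + 1\<close>. On the interval in between \<open>u u'\<close> is at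
most its value 0 at the right endpoint, so the square is at most 1. The value at the point 1 then
bounds \<open>\<beta>\<^sub>n\<close>, and a limit point \<open>b\<close> of the slopes gives a solution bounded by 1 on the half line,
which decays.
\<close>

lemma exists_decaying_solution:
  obtains u u' where "solves V u u'" "u 0 = 1" "(u \<longlongrightarrow> 0) at_top"
proof -
  obtain c c' where c: "solves V c c'" "c 0 = 1" "c' 0 = 0" using initial_value_problem by blast
  obtain s s' where s: "solves V s s'" "s 0 = 0" "s' 0 = 1" using initial_value_problem by blast
  have s0: "s x \<noteq> 0" if "0 < x" for x
  proof
    assume "s x = 0"
    then have "s y = 0" for y using solves_zero_of_two_zeros[OF s(1,2)] that by blast
    then have "s = (\<lambda>y. 0)" by auto
    then have "(s has_real_derivative 0) (at 0)" by simp
    then show False using solves_has_derivative[OF s(1), of 0] s(3) DERIV_unique by fastforce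
  qed
  define \<beta> where "\<beta> n = - c (real n + 1) / s (real n + 1)" for n
  have bound: "(1 * c x + \<beta> n * s x) * (1 * c x + \<beta> n * s x) \<le> 1" if "0 \<le> x" "x \<le> real n + 1" for n x
  proof -
    let ?N = "real n + 1"
    note sol = solves_linear_combination[OF c(1) s(1), of 1 "\<beta> n"]
    have "1 * c ?N + \<beta> n * s ?N = 0" using s0[of ?N] by (simp add: \<beta>_def)
    then have "(1 * c x + \<beta> n * s x) * (1 * c' x + \<beta> n * s' x) \<le> 0"
      using solves_product_mono[OF sol that(2)] by simp
    from solves_square_antimono[OF sol that(1) this]
    show ?thesis using c s by simp
  qed
  have "norm (\<beta> n) \<le> (1 + \<bar>c 1\<bar>) / \<bar>s 1\<bar>" for n
  proof -
    have "\<bar>c 1 + \<beta> n * s 1\<bar> \<le> 1"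
      using bound[of 1 n] abs_square_le_1[of "c 1 + \<beta> n * s 1"] by (simp add: power2_eq_square)
    then have "\<bar>\<beta> n * s 1\<bar> \<le> 1 + \<bar>c 1\<bar>" by linarith
    then show ?thesis using s0[of 1] by (simp add: abs_mult le_divide_eq)
  qed
  then have "bounded (range \<beta>)" by (auto simp: bounded_iff)
  then obtain b r where r: "strict_mono r" "(\<beta> \<circ> r) \<longlonglongrightarrow> b"
    using bounded_imp_convergent_subsequence by blast
  have lim: "(1 * c x + b * s x) * (1 * c x + b * s x) \<le> 1" if "0 \<le> x" for x
  proof (rule LIMSEQ_le_const2)
    show "(\<lambda>n. (1 * c x + (\<beta> \<circ> r) n * s x) * (1 * c x + (\<beta> \<circ> r) n * s x))
        \<longlonglongrightarrow> (1 * c x + b * s x) * (1 * c x + b * s x)"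
      by (intro tendsto_intros r(2))
    have "x \<le> real (r n) + 1" if "nat \<lceil>x\<rceil> \<le> n" for n
      using seq_suble[OF r(1), of n] that by linarith
    then show "\<exists>N. \<forall>n\<ge>N. (1 * c x + (\<beta> \<circ> r) n * s x) * (1 * c x + (\<beta> \<circ> r) n * s x) \<le> 1"
      using bound \<open>0 \<le> x\<close> unfolding comp_def by blast
  qed
  note sol = solves_linear_combination[OF c(1) s(1), of 1 b]
  show thesis
    using that[OF sol] bounded_solution_decays[OF sol lim] c s by simp
qed

text \<open>
A sign change would produce a zero, and a decaying solution with a zero vanishes identically.
\<close>

lemma decaying_solution_positive:
  assumes s: "solves V u u'" and lim: "(u \<longlongrightarrow> 0) at_top" and u0: "u 0 = 1"
  shows "0 < u x"
proof (rule ccontr)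
  assume "\<not> 0 < u x"
  then have x: "u x \<le> 0" by simp
  have cont: "continuous_on {a..b} u" for a b
    using solves_continuous(1)[OF s] continuous_on_subset by blast
  have "\<exists>p. u p = 0"
  proof (cases "0 \<le> x")
    case True
    then show ?thesis using IVT2'[of u x 0 0] cont x u0 by auto
  next
    case False
    then show ?thesis using IVT'[of u x 0 0] cont x u0 by auto
  qed
  then show False using decaying_solution_zero[OF s lim, of _ 0] u0 by fastforce
qed

text \<open>
Both bounds concern \<open>w = u' + k u\<close> and the monotonicity of \<open>e^(- k x) w\<close>. For \<open>k = sqrt v0\<close> a
positive value \<open>w x\<close> would force \<open>k u \<ge> w x\<close> to the right of \<open>x\<close>, against decay. For
\<open>k = sqrt v1\<close> a negative value would bound the slope of \<open>u\<close> by \<open>w x < 0\<close> and drive \<open>u\<close> below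
zero.
\<close>

lemma decaying_solution_log_derivative_bounds:
  assumes s: "solves V u u'" and lim: "(u \<longlongrightarrow> 0) at_top" and u0: "u 0 = 1"
  shows "u' x \<le> - sqrt v0 * u x" "- sqrt v1 * u x \<le> u' x"
proof -
  note pos = decaying_solution_positive[OF assms]
  have neg: "u' x \<le> 0" for x
    using decaying_solution_product_nonpos[OF s lim, of x] pos[of x] by (simp add: mult_le_0_iff)
  have sq: "sqrt v0 * sqrt v0 = v0" "sqrt v1 * sqrt v1 = v1" "sqrt v0 > 0" "sqrt v1 > 0"
    using v0_pos v0_le_v1 by auto
  have ac: "ac_deriv (\<lambda>x. u' x + k * u x) (\<lambda>x. V x * u x + k * u' x)" for k
    using s by (intro ac_deriv_add ac_deriv_cmul) (auto simp: solves_def)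
  show "u' x \<le> - sqrt v0 * u x"
  proof (rule ccontr)
    define k where "k = sqrt v0"
    define w where "w x = u' x + k * u x" for x
    assume "\<not> ?thesis"
    then have w: "w x > 0" by (simp add: w_def k_def)
    have "w x \<le> k * u y" if "x \<le> y" for y
    proof -
      have "exp (- k * x) * w x \<le> exp (- k * y) * w y"
        unfolding w_def
      proof (rule ac_deriv_mono[OF ac_deriv_exp_mult[OF ac] that])
        fix t
        have "V t * u t + k * u' t + - k * (u' t + k * u t) = (V t - v0) * u t"
          using sq by (simp add: k_def algebra_simps)
        also have "\<dots> \<ge> 0" using V_lower[of t] pos[of t] by simp
        finally show "0 \<le> exp (- k * t) * (V t * u t + k * u' t + - k * (u' t + k * u t))" by simp
      qed
      moreover have "exp (- k * y) \<le> exp (- k * x)" using that sq by (simp add: k_def)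
      ultimately have "exp (- k * x) * w x \<le> exp (- k * x) * w y"
        using w by (smt (verit) exp_gt_zero mult_right_mono zero_less_mult_iff)
      then have "w x \<le> w y" by simp
      then show ?thesis using neg[of y] by (simp add: w_def)
    qed
    moreover have "\<forall>\<^sub>F y in at_top. dist (u y) 0 < w x / k"
      using lim w sq by (intro tendstoD) (auto simp: k_def)
    then obtain b where b: "\<And>y. b \<le> y \<Longrightarrow> \<bar>u y\<bar> < w x / k"
      by (auto simp: eventually_at_top_linorder)
    have "\<bar>u (max b x)\<bar> < w x / k" by (rule b) simp
    then have "u (max b x) < w x / k" by linarith
    then have "k * u (max b x) < w x" using sq by (simp add: k_def less_divide_eq mult.commute)
    ultimately show False by (meson max.cobounded2 not_le)
  qed
  show "- sqrt v1 * u x \<le> u' x"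
  proof (rule ccontr)
    define k where "k = sqrt v1"
    define w where "w x = u' x + k * u x" for x
    assume "\<not> ?thesis"
    then have w: "w x < 0" by (simp add: w_def k_def)
    have slope: "u' y \<le> w x" if "x \<le> y" for y
    proof -
      have "exp (- k * y) * w y \<le> exp (- k * x) * w x"
        unfolding w_def
      proof (rule ac_deriv_antimono[OF ac_deriv_exp_mult[OF ac] that])
        fix t
        have "V t * u t + k * u' t + - k * (u' t + k * u t) = (V t - v1) * u t"
          using sq by (simp add: k_def algebra_simps)
        also have "\<dots> \<le> 0" using V_upper[of t] pos[of t] by (simp add: mult_le_0_iff)
        finally show "exp (- k * t) * (V t * u t + k * u' t + - k * (u' t + k * u t)) \<le> 0"
          by (simp add: mult_le_0_iff)
      qed
      moreover have "exp (- k * x) * w x \<le> exp (- k * y) * w x"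
        using that sq w by (intro mult_right_mono_neg) (auto simp: k_def)
      ultimately have "exp (- k * y) * w y \<le> exp (- k * y) * w x" by linarith
      then have "w y \<le> w x" by simp
      moreover have "0 < k * u y" using pos[of y] sq by (simp add: k_def)
      ultimately show ?thesis unfolding w_def[of y] by linarith
    qed
    \<comment> \<open>A line through \<open>(x, u x)\<close> with slope \<open>w x\<close> meets the axis at \<open>y\<close>.\<close>
    define y where "y = x + u x / (- w x)"
    have y: "x \<le> y" using w pos[of x] by (simp add: y_def divide_le_0_iff)
    have "u y - w x * y \<le> u x - w x * x"
    proof (rule DERIV_nonpos_imp_nonincreasing[OF y])
      fix t assume "x \<le> t" "t \<le> y"
      have "((\<lambda>x'. u x' - w x * x') has_real_derivative u' t - w x) (at t)"
        by (rule derivative_eq_intros solves_has_derivative[OF s] refl | simp)+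
      then show "\<exists>d. ((\<lambda>x'. u x' - w x * x') has_real_derivative d) (at t) \<and> d \<le> 0"
        using slope[OF \<open>x \<le> t\<close>] by force
    qed
    moreover have "w x * y = w x * x - u x" using w by (simp add: y_def algebra_simps)
    ultimately show False using pos[of y] by simp
  qed
qed

lemma decaying_solution_exp_mono:
  assumes s: "solves V u u'" and lim: "(u \<longlongrightarrow> 0) at_top" and u0: "u 0 = 1" and "x \<le> y"
  shows "exp (sqrt v0 * y) * u y \<le> exp (sqrt v0 * x) * u x"
    and "exp (sqrt v1 * x) * u x \<le> exp (sqrt v1 * y) * u y"
proof -
  note b = decaying_solution_log_derivative_bounds[OF assms(1-3)]
  have ac: "ac_deriv u u'" using s by (simp add: solves_def)
  show "exp (sqrt v0 * y) * u y \<le> exp (sqrt v0 * x) * u x"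
  proof (rule ac_deriv_antimono[OF ac_deriv_exp_mult[OF ac] \<open>x \<le> y\<close>])
    fix t show "exp (sqrt v0 * t) * (u' t + sqrt v0 * u t) \<le> 0"
      using b(1)[of t] by (simp add: mult_le_0_iff)
  qed
  show "exp (sqrt v1 * x) * u x \<le> exp (sqrt v1 * y) * u y"
  proof (rule ac_deriv_mono[OF ac_deriv_exp_mult[OF ac] \<open>x \<le> y\<close>])
    fix t show "0 \<le> exp (sqrt v1 * t) * (u' t + sqrt v1 * u t)"
      using b(2)[of t] by simp
  qed
qed

text \<open>
Compare \<open>x\<close> with the normalization at 0. Which of the two exponents gives the upper bound depends on
the sign of \<open>x\<close>; the minimum and the maximum cover both cases.
\<close>

lemma decaying_solution_bounds:
  assumes s: "solves V u u'" and lim: "(u \<longlongrightarrow> 0) at_top" and u0: "u 0 = 1"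
  shows "exp (- max (sqrt v0 * x) (sqrt v1 * x)) \<le> u x"
    and "u x \<le> exp (- min (sqrt v0 * x) (sqrt v1 * x))"
proof -
  note m = decaying_solution_exp_mono[OF assms]
  have le: "sqrt v0 \<le> sqrt v1" using v0_le_v1 by simp
  have *: "u x = exp (- (k * x)) * (exp (k * x) * u x)" for k by (simp add: exp_minus)
  have up: "u x \<le> exp (- (k * x))" if "exp (k * x) * u x \<le> 1" for k
    using mult_left_mono[OF that, of "exp (- (k * x))"] *[of k] by simp
  have lo: "exp (- (k * x)) \<le> u x" if "1 \<le> exp (k * x) * u x" for k
    using mult_left_mono[OF that, of "exp (- (k * x))"] *[of k] by simp
  have "exp (- max (sqrt v0 * x) (sqrt v1 * x)) \<le> u x \<and> u x \<le> exp (- min (sqrt v0 * x) (sqrt v1 * x))"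
  proof (cases "0 \<le> x")
    case True
    then have "sqrt v0 * x \<le> sqrt v1 * x" using le by (intro mult_right_mono) auto
    then show ?thesis
      using m(1)[OF True] m(2)[OF True] u0 up lo by (auto simp: max_def min_def)
  next
    case False
    then have "x \<le> 0" by simp
    then have "sqrt v1 * x \<le> sqrt v0 * x" using le by (intro mult_right_mono_neg) auto
    then show ?thesis
      using m(1)[OF \<open>x \<le> 0\<close>] m(2)[OF \<open>x \<le> 0\<close>] u0 up lo by (auto simp: max_def min_def)
  qed
  then show "exp (- max (sqrt v0 * x) (sqrt v1 * x)) \<le> u x" "u x \<le> exp (- min (sqrt v0 * x) (sqrt v1 * x))"
    by auto
qed

end

section \<open>Sobolev functions and the essential supremum\<close>

lemma AE_lebesgue_meets_open:
  fixes S :: "real set"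
  assumes "AE x in lebesgue. P x" "open S" "S \<noteq> {}"
  obtains x where "x \<in> S" "P x"
proof -
  obtain N where N: "N \<in> null_sets lebesgue" "\<And>x. x \<in> space lebesgue - N \<Longrightarrow> P x"
    using AE_E3[OF assms(1)] by metis
  have "\<not> S \<subseteq> N"
    using open_not_negligible[OF assms(2,3)] N(1) negligible_subset negligible_iff_null_sets by blast
  then show thesis using that N(2) by auto
qed

lemma continuous_zero_of_AE_zero:
  fixes f :: "real \<Rightarrow> real"
  assumes "continuous_on UNIV f" "AE x in lebesgue. f x = 0"
  shows "f x = 0"
proof (rule ccontr)
  assume "f x \<noteq> 0"
  have "open {x. f x \<noteq> 0}"
    by (intro open_Collect_neq assms(1) continuous_intros)
  then obtain y where "y \<in> {x. f x \<noteq> 0}" "f y = 0"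
    using AE_lebesgue_meets_open[OF assms(2)] \<open>f x \<noteq> 0\<close> by blast
  then show False by simp
qed

lemma continuous_borel_measurable_lebesgue:
  assumes "continuous_on UNIV (f :: real \<Rightarrow> real)"
  shows "f \<in> borel_measurable lebesgue"
  using borel_measurable_continuous_onI[OF assms] by (intro measurable_completion) simp

text \<open>
A value above the essential supremum would be exceeded on a nonempty open set, which is not
negligible.
\<close>

lemma continuous_abs_le_Linf_norm:
  assumes f: "continuous_on UNIV f"
  shows "ereal \<bar>f x\<bar> \<le> Linf_norm f"
proof (rule ccontr)
  assume "\<not> ereal \<bar>f x\<bar> \<le> Linf_norm f"
  then have "x \<in> {x. Linf_norm f < ereal \<bar>f x\<bar>}" by simp
  moreover have "open {x. Linf_norm f < ereal \<bar>f x\<bar>}"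
    by (intro open_Collect_less continuous_intros continuous_on_ereal f)
  moreover have "AE x in lebesgue. ereal \<bar>f x\<bar> \<le> Linf_norm f"
    unfolding Linf_norm_def by (rule esssup_AE)
  ultimately obtain y where "y \<in> {x. Linf_norm f < ereal \<bar>f x\<bar>}" "ereal \<bar>f y\<bar> \<le> Linf_norm f"
    using AE_lebesgue_meets_open[of "\<lambda>x. ereal \<bar>f x\<bar> \<le> Linf_norm f"] by blast
  then show False by simp
qed

lemma Linf_norm_leI:
  assumes "f \<in> borel_measurable lebesgue" "\<And>x. \<bar>f x\<bar> \<le> B"
  shows "Linf_norm f \<le> ereal B"
  unfolding Linf_norm_def
proof (rule esssup_I)
  show "(\<lambda>x. ereal \<bar>f x\<bar>) \<in> borel_measurable lebesgue"
    using assms(1) by measurable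
qed (use assms in auto)

lemma locally_bounded_Linf_loc:
  assumes "f \<in> borel_measurable lebesgue" "\<And>a b. bounded (f ` {a..b})"
  shows "f \<in> Linf_loc"
  unfolding Linf_loc_def
proof (intro CollectI allI impI)
  fix K :: "real set" assume K: "compact K"
  then obtain a where a: "K \<subseteq> {-a..a}"
    by (metis bounded_subset_cbox_symmetric box_real(2) compact_imp_bounded)
  obtain B where B: "\<And>x. x \<in> {-a..a} \<Longrightarrow> \<bar>f x\<bar> \<le> B"
    using assms(2)[of "-a" a] unfolding bounded_iff ball_simps real_norm_def by blast
  have "K \<in> sets lebesgue" using lmeasurable_compact[OF K] by (rule fmeasurableD)
  then have m: "(\<lambda>x. indicator K x * f x) \<in> borel_measurable lebesgue"
    using assms(1) by (intro borel_measurable_times borel_measurable_indicator)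
  have "\<bar>indicator K x * f x\<bar> \<le> max 0 B" for x
    using B[of x] a by (auto simp: indicator_def max_def)
  from Linf_norm_leI[OF m this] have "Linf_norm (\<lambda>x. indicator K x * f x) < \<infinity>"
    by (rule le_less_trans) (simp add: less_ereal.simps(4) del: ereal_max)
  then show "(\<lambda>x. indicator K x * f x) \<in> Linf" using m by (simp add: Linf_def)
qed

text \<open>
An indefinite integral of \<open>h\<close> has weak derivative 0 as well as \<open>h\<close>, and both are almost everywhere
derivatives in the integral sense.
\<close>

lemma AE_zero_of_test_functions:
  assumes h: "h \<in> L1_loc" and z: "\<And>\<psi>. test_function \<psi> \<Longrightarrow> (LINT x|lebesgue. h x * \<psi> x) = 0"
  shows "AE x in lebesgue. h x = 0"
proof -
  have ac: "ac_deriv (primitive_from_0 h) h"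
    using h by (intro ac_deriv_primitive L1_loc_abs_integrable)
  note c = ac_deriv_continuous[OF ac]
  have "(\<lambda>x. 0) \<in> L1_loc" by (intro continuous_L1_loc continuous_intros)
  then have "has_weak_deriv 1 (primitive_from_0 h) (\<lambda>x. 0)"
    using ac_deriv_integral_test_function[OF ac] z continuous_L1_loc[OF c]
    by (simp add: has_weak_deriv_def)
  then have "ac_deriv (primitive_from_0 h) (\<lambda>x. 0)"
    using has_weak_deriv_1_iff[OF c] by blast
  then show ?thesis using ac_deriv_unique[OF ac] by simp
qed

lemma has_weak_deriv_0_self: "f \<in> L1_loc \<Longrightarrow> has_weak_deriv 0 f f"
  by (simp add: has_weak_deriv_def)

lemma has_weak_deriv_0_AE:
  assumes "has_weak_deriv 0 f g"
  shows "AE x in lebesgue. f x = g x"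
proof -
  have fg: "f \<in> L1_loc" "g \<in> L1_loc" using assms by (auto simp: has_weak_deriv_def)
  have "AE x in lebesgue. f x - g x = 0"
  proof (rule AE_zero_of_test_functions)
    show "(\<lambda>x. f x - g x) \<in> L1_loc"
      using fg by (auto simp: L1_loc_iff)
    fix \<psi> assume "test_function \<psi>"
    then show "(LINT x|lebesgue. (f x - g x) * \<psi> x) = 0"
      using assms integrable_mult_test_function fg
      by (simp add: has_weak_deriv_def left_diff_distrib)
  qed
  then show ?thesis by simp
qed

lemma L2_iff: "f \<in> L2 \<longleftrightarrow> f \<in> borel_measurable lebesgue \<and> integrable lebesgue (\<lambda>x. f x * f x)"
  by (simp add: L2_def power2_eq_square)

lemma L2_mult_integrable:
  assumes "f \<in> L2" "g \<in> L2"
  shows "integrable lebesgue (\<lambda>x. f x * g x)"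
proof (rule Bochner_Integration.integrable_bound)
  show "integrable lebesgue (\<lambda>x. f x * f x + g x * g x)"
    using assms by (auto simp: L2_iff)
  show "(\<lambda>x. f x * g x) \<in> borel_measurable lebesgue"
    using assms by (auto simp: L2_iff)
  have "\<bar>f x * g x\<bar> \<le> f x * f x + g x * g x" for x
  proof -
    have "2 * \<bar>f x * g x\<bar> \<le> f x * f x + g x * g x"
      using sum_squares_bound[of "\<bar>f x\<bar>" "\<bar>g x\<bar>"] by (simp add: power2_eq_square abs_mult mult.assoc)
    then show ?thesis using abs_ge_zero[of "f x * g x"] by linarith
  qed
  then show "AE x in lebesgue. norm (f x * g x) \<le> norm (f x * f x + g x * g x)" by simp
qed

lemma L2_diff:
  assumes "f \<in> L2" "g \<in> L2"
  shows "(\<lambda>x. f x - g x) \<in> L2"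
proof -
  have "integrable lebesgue (\<lambda>x. f x * f x - 2 * (f x * g x) + g x * g x)"
    using assms L2_mult_integrable by (intro Bochner_Integration.integrable_add
        Bochner_Integration.integrable_diff integrable_mult_right) auto
  moreover have "(\<lambda>x. f x * f x - 2 * (f x * g x) + g x * g x) = (\<lambda>x. (f x - g x) * (f x - g x))"
    by (auto simp: algebra_simps)
  moreover have "(\<lambda>x. f x - g x) \<in> borel_measurable lebesgue"
    using assms by (intro borel_measurable_diff) (auto simp: L2_iff)
  ultimately show ?thesis by (simp add: L2_iff)
qed

lemma L2_cong_AE:
  assumes "f \<in> L2" "AE x in lebesgue. f x = g x"
  shows "g \<in> L2"
proof -
  have g: "g \<in> borel_measurable lebesgue"
    using borel_measurable_AE assms by (auto simp: L2_iff)
  have "integrable lebesgue (\<lambda>x. g x * g x)"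
  proof (rule integrable_cong_AE_imp)
    show "integrable lebesgue (\<lambda>x. f x * f x)" using assms(1) by (simp add: L2_iff)
    show "AE x in lebesgue. f x * f x = g x * g x" using assms(2) by eventually_elim simp
  qed (use g in measurable)
  then show ?thesis using g by (simp add: L2_iff)
qed

lemma H1_iff: "w \<in> H1 \<longleftrightarrow> w \<in> L2 \<and> (\<exists>g \<in> L2. ac_deriv w g)"
proof
  assume "w \<in> H1"
  then have c: "continuous_on UNIV w" and *: "\<And>j. j \<le> 1 \<Longrightarrow> \<exists>g\<in>L2. has_weak_deriv j w g"
    by (auto simp: H1_def sobolev_def)
  obtain g0 where "g0 \<in> L2" "has_weak_deriv 0 w g0" using *[of 0] by auto
  then have "w \<in> L2" using L2_cong_AE[of g0 w] has_weak_deriv_0_AE[of w g0] by (simp add: eq_commute)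
  then show "w \<in> L2 \<and> (\<exists>g \<in> L2. ac_deriv w g)"
    using *[of 1] has_weak_deriv_1_iff[OF c] by auto
next
  assume "w \<in> L2 \<and> (\<exists>g \<in> L2. ac_deriv w g)"
  then obtain g where g: "w \<in> L2" "g \<in> L2" "ac_deriv w g" by blast
  note c = ac_deriv_continuous[OF g(3)]
  have "\<exists>g\<in>L2. has_weak_deriv j w g" if "j \<le> 1" for j
  proof (cases "j = 0")
    case True
    then show ?thesis using g(1) has_weak_deriv_0_self[OF continuous_L1_loc[OF c]] by blast
  next
    case False
    then have "j = 1" using that by simp
    then show ?thesis using g has_weak_deriv_1_iff[OF c] by blast
  qed
  then show "w \<in> H1" using c by (simp add: H1_def sobolev_def)
qed

lemma integrable_exp_neg_abs:
  fixes a k :: real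
  assumes "0 < k"
  shows "integrable lebesgue (\<lambda>x. exp (- k * \<bar>x - a\<bar>))"
proof -
  define f where "f x = indicator {0..} x *\<^sub>R exp (- k * x)" for x :: real
  have [measurable]: "f \<in> borel_measurable borel" unfolding f_def by measurable
  have "(\<lambda>x. exp (- k * x)) absolutely_integrable_on {0..}"
    using has_integral_exp_minus_to_infinity[OF assms, of 0]
    by (intro nonnegative_absolutely_integrable_1) auto
  then have "integrable lebesgue f" by (simp add: set_integrable_def f_def[abs_def])
  then have f: "integrable lborel f" by (subst (asm) integrable_completion) auto
  have "integrable lborel (\<lambda>x. f (- a + 1 * x) + f (a + (-1) * x))"
    by (intro Bochner_Integration.integrable_add lborel_integrable_real_affine f) auto
  then have "integrable lborel (\<lambda>x. exp (- k * \<bar>x - a\<bar>))"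
    by (rule Bochner_Integration.integrable_bound) (auto simp: f_def indicator_def algebra_simps)
  then show ?thesis by (subst integrable_completion) auto
qed

definition glue :: "real \<Rightarrow> (real \<Rightarrow> real) \<Rightarrow> (real \<Rightarrow> real) \<Rightarrow> real \<Rightarrow> real" where
  "glue a f g x = (if x < a then f x else g x)"

lemma ac_deriv_glue:
  assumes f: "ac_deriv f f'" and g: "ac_deriv g g'" and eq: "f a = g a"
  shows "ac_deriv (glue a f g) (glue a f' g')"
proof -
  have left: "glue a f' g' absolutely_integrable_on {c..d} \<and>
      (glue a f' g' has_integral glue a f g d - glue a f g c) {c..d}" if "c \<le> d" "d \<le> a" for c d
  proof -
    have e: "glue a f' g' x = f' x" if "x \<in> {c..d} - {a}" for x
      using that \<open>d \<le> a\<close> by (auto simp: glue_def)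
    have "glue a f g d = f d" "glue a f g c = f c"
      using that eq by (cases "c = a"; force simp: glue_def)+
    moreover have "glue a f' g' absolutely_integrable_on {c..d}"
      by (rule absolutely_integrable_spike[OF ac_deriv_abs_integrable[OF f] negligible_sing e])
    moreover have "(glue a f' g' has_integral f d - f c) {c..d}"
      by (rule has_integral_spike[OF negligible_sing e ac_deriv_has_integral[OF f that(1)]])
    ultimately show ?thesis by simp
  qed
  have right: "glue a f' g' absolutely_integrable_on {c..d} \<and>
      (glue a f' g' has_integral glue a f g d - glue a f g c) {c..d}" if "c \<le> d" "a \<le> c" for c d
  proof -
    have e: "glue a f' g' x = g' x" if "x \<in> {c..d} - {}" for x
      using that \<open>a \<le> c\<close> by (auto simp: glue_def)
    have "glue a f g d = g d" "glue a f g c = g c"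
      using that by (auto simp: glue_def)
    moreover have "glue a f' g' absolutely_integrable_on {c..d}"
      by (rule absolutely_integrable_spike[OF ac_deriv_abs_integrable[OF g] negligible_empty e])
    moreover have "(glue a f' g' has_integral g d - g c) {c..d}"
      by (rule has_integral_spike[OF negligible_empty e ac_deriv_has_integral[OF g that(1)]])
    ultimately show ?thesis by simp
  qed
  have "glue a f' g' absolutely_integrable_on {c..d} \<and>
      (glue a f' g' has_integral glue a f g d - glue a f g c) {c..d}" if "c \<le> d" for c d
  proof (cases "c \<le> a \<and> a \<le> d")
    case True
    then show ?thesis
      using left[of c a] right[of a d] absolutely_integrable_on_combine[where f = "glue a f' g'" and a = c and c = a and b = d]
        Henstock_Kurzweil_Integration.has_integral_combine[of c a d "glue a f' g'"
          "glue a f g a - glue a f g c" "glue a f g d - glue a f g a"]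
      by simp
  next
    case False
    then show ?thesis using left[OF that] right[OF that] by linarith
  qed
  then show ?thesis by (intro ac_derivI) auto
qed

section \<open>Reflection and the quadratic form\<close>

context potential
begin

lemma decaying_at_bot_reflect:
  assumes "solves V u u'" "(u \<longlongrightarrow> 0) at_bot"
  shows "solves (\<lambda>x. V (- x)) (\<lambda>x. u (- x)) (\<lambda>x. - u' (- x))" "((\<lambda>x. u (- x)) \<longlongrightarrow> 0) at_top"
  using solves_reflect[OF assms(1)] assms(2) by (auto simp: filterlim_at_bot_mirror)

lemma exists_decaying_solution_at_bot:
  obtains u u' where "solves V u u'" "u 0 = 1" "(u \<longlongrightarrow> 0) at_bot"
proof -
  interpret r: potential "\<lambda>x. V (- x)" v0 v1 by (rule reflected_potential)
  obtain u u' where u: "solves (\<lambda>x. V (- x)) u u'" "u 0 = 1" "(u \<longlongrightarrow> 0) at_top"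
    using r.exists_decaying_solution by blast
  show thesis
    using that[of "\<lambda>x. u (- x)"] solves_reflect[OF u(1)] u(2,3) by (simp add: filterlim_at_bot_mirror)
qed

lemma decaying_solution_at_bot_unique:
  assumes "solves V u u'" "(u \<longlongrightarrow> 0) at_bot" "solves V w w'" "(w \<longlongrightarrow> 0) at_bot" "u 0 = w 0"
  shows "u = w"
proof -
  interpret r: potential "\<lambda>x. V (- x)" v0 v1 by (rule reflected_potential)
  have "(\<lambda>x. u (- x)) = (\<lambda>x. w (- x))"
    using assms(5)
    by (intro r.decaying_solution_unique[OF decaying_at_bot_reflect[OF assms(1,2)]
          decaying_at_bot_reflect[OF assms(3,4)]]) simp
  then show ?thesis by (metis (no_types) ext minus_minus)
qed

lemma decaying_solution_at_bot_bounds: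
  assumes s: "solves V u u'" and lim: "(u \<longlongrightarrow> 0) at_bot" and u0: "u 0 = 1"
  shows "exp (min (sqrt v0 * x) (sqrt v1 * x)) \<le> u x"
    and "u x \<le> exp (max (sqrt v0 * x) (sqrt v1 * x))"
proof -
  interpret r: potential "\<lambda>x. V (- x)" v0 v1 by (rule reflected_potential)
  note * = r.decaying_solution_bounds[OF decaying_at_bot_reflect[OF s lim], of "- x"]
  have m: "- max (- p) (- q) = min p q" "- min (- p) (- q) = max p q" for p q :: real
    by (auto simp: max_def min_def)
  show "exp (min (sqrt v0 * x) (sqrt v1 * x)) \<le> u x" "u x \<le> exp (max (sqrt v0 * x) (sqrt v1 * x))"
    using * u0 by (simp_all add: m)
qed

lemma normalized_decaying_solution:
  assumes s: "solves V u u'" and lim: "(u \<longlongrightarrow> 0) at_top" and u0: "u 0 = 1" and "a \<le> x"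
  shows "0 < u x / u a \<and> u x / u a \<le> exp (- sqrt v0 * \<bar>x - a\<bar>) \<and> \<bar>u' x / u a\<bar> \<le> sqrt v1 * (u x / u a)"
proof -
  note pos = decaying_solution_positive[OF s lim u0]
  have "exp (sqrt v0 * x) * u x \<le> exp (sqrt v0 * a) * u a"
    by (rule decaying_solution_exp_mono[OF s lim u0 \<open>a \<le> x\<close>])
  then have "exp (- (sqrt v0 * x)) * (exp (sqrt v0 * x) * u x) \<le> exp (- (sqrt v0 * x)) * (exp (sqrt v0 * a) * u a)"
    by (intro mult_left_mono) auto
  moreover have "exp (- (sqrt v0 * x)) * exp (sqrt v0 * x) = 1"
    "exp (- (sqrt v0 * x)) * exp (sqrt v0 * a) = exp (- sqrt v0 * \<bar>x - a\<bar>)"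
    unfolding exp_add[symmetric] using \<open>a \<le> x\<close> by (simp_all add: right_diff_distrib)
  ultimately have "u x \<le> exp (- sqrt v0 * \<bar>x - a\<bar>) * u a"
    by (metis mult.assoc mult_1)
  moreover have "\<bar>u' x\<bar> \<le> sqrt v1 * u x"
  proof -
    have "0 \<le> sqrt v0 * u x" using pos[of x] v0_pos by simp
    then show ?thesis
      using decaying_solution_log_derivative_bounds[OF s lim u0, of x] pos[of x] by (simp add: abs_le_iff)
  qed
  ultimately show ?thesis
    using pos[of x] pos[of a] by (simp add: divide_le_eq divide_right_mono)
qed

lemma normalized_decaying_solution_at_bot:
  assumes s: "solves V u u'" and lim: "(u \<longlongrightarrow> 0) at_bot" and u0: "u 0 = 1" and "x \<le> a"
  shows "0 < u x / u a \<and> u x / u a \<le> exp (- sqrt v0 * \<bar>x - a\<bar>) \<and> \<bar>u' x / u a\<bar> \<le> sqrt v1 * (u x / u a)"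
proof -
  interpret r: potential "\<lambda>x. V (- x)" v0 v1 by (rule reflected_potential)
  show ?thesis
    using r.normalized_decaying_solution[OF decaying_at_bot_reflect[OF s lim], of "- a" "- x"] u0 \<open>x \<le> a\<close>
    by (simp add: abs_minus_commute)
qed

lemma L2_V_mult:
  assumes "f \<in> L2"
  shows "(\<lambda>x. V x * f x) \<in> L2"
proof -
  have m: "(\<lambda>x. V x * f x) \<in> borel_measurable lebesgue"
    using assms V_measurable by (auto simp: L2_iff)
  have "integrable lebesgue (\<lambda>x. (V x * f x) * (V x * f x))"
  proof (rule Bochner_Integration.integrable_bound)
    show "integrable lebesgue (\<lambda>x. (v1 * v1) * (f x * f x))"
      using assms by (auto simp: L2_iff)
    have "V x * V x * (f x * f x) \<le> v1 * v1 * (f x * f x)" for x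
      using V_pos[of x] V_upper[of x] by (intro mult_right_mono mult_mono zero_le_square) auto
    then have "\<bar>V x * f x * (V x * f x)\<bar> \<le> \<bar>v1 * v1 * (f x * f x)\<bar>" for x
      using abs_of_nonneg[OF zero_le_square[of "V x * f x"]] abs_ge_self[of "v1 * v1 * (f x * f x)"]
      by (simp only: mult_ac) (meson order_trans)
    then show "AE x in lebesgue. norm ((V x * f x) * (V x * f x)) \<le> norm ((v1 * v1) * (f x * f x))"
      by simp
  qed (use m in auto)
  then show ?thesis using m by (simp add: L2_iff)
qed

lemma V_norm_sq_eq:
  assumes "ac_deriv w g" "g \<in> L2" "w \<in> L2"
  shows "V_norm_sq V w = (LINT x|lebesgue. g x * g x + V x * w x * w x)"
  unfolding V_norm_sq_def
proof (rule integral_cong_AE)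
  have ae: "AE x in lebesgue. weak_deriv 1 w x = g x" by (rule weak_deriv_1_AE(2)[OF assms(1)])
  then have "weak_deriv 1 w \<in> borel_measurable lebesgue"
    using borel_measurable_AE[of g "weak_deriv 1 w"] assms(2) by (simp add: L2_iff eq_commute)
  then show "(\<lambda>x. \<bar>weak_deriv 1 w x\<bar>\<^sup>2 + V x * \<bar>w x\<bar>\<^sup>2) \<in> borel_measurable lebesgue"
    using assms V_measurable by (auto simp: L2_iff)
  show "(\<lambda>x. g x * g x + V x * w x * w x) \<in> borel_measurable lebesgue"
    using assms V_measurable by (auto simp: L2_iff)
  show "AE x in lebesgue. \<bar>weak_deriv 1 w x\<bar>\<^sup>2 + V x * \<bar>w x\<bar>\<^sup>2 = g x * g x + V x * w x * w x"
    using ae by eventually_elim (simp add: power2_eq_square)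
qed

end

section \<open>The minimization problem\<close>

text \<open>
The candidate is glued at \<open>a\<close> from a solution \<open>p\<close> on the left and a solution \<open>q\<close> on the right. All
that the variational argument uses about them are the normalization at \<open>a\<close> and the exponential decay
of the values and the derivatives on their half lines.
\<close>

locale peaked_profile = potential +
  fixes a :: real and p p' q q' :: "real \<Rightarrow> real"
  assumes p: "solves V p p'" and q: "solves V q q'" and pa: "p a = 1" and qa: "q a = 1"
    and p_bounds: "\<And>x. x \<le> a \<Longrightarrow>
      0 < p x \<and> p x \<le> exp (- sqrt v0 * \<bar>x - a\<bar>) \<and> \<bar>p' x\<bar> \<le> sqrt v1 * p x"
    and q_bounds: "\<And>x. a \<le> x \<Longrightarrow>
      0 < q x \<and> q x \<le> exp (- sqrt v0 * \<bar>x - a\<bar>) \<and> \<bar>q' x\<bar> \<le> sqrt v1 * q x"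
begin

abbreviation "u \<equiv> glue a p q"
abbreviation "u' \<equiv> glue a p' q'"

lemma u_pos: "0 < u x"
  and u_le: "u x \<le> exp (- sqrt v0 * \<bar>x - a\<bar>)"
  and u'_le: "\<bar>u' x\<bar> \<le> sqrt v1 * u x"
  using p_bounds[of x] q_bounds[of x] by (auto simp: glue_def)

lemma ac_deriv_u: "ac_deriv u u'"
  using p q pa qa by (intro ac_deriv_glue) (auto simp: solves_def)

lemma u_le_1: "u x \<le> 1"
proof -
  have "exp (- sqrt v0 * \<bar>x - a\<bar>) \<le> 1" using v0_pos by simp
  then show ?thesis using u_le[of x] by linarith
qed

lemma u_L2: "u \<in> L2"
proof -
  have m: "u \<in> borel_measurable lebesgue"
    by (intro continuous_borel_measurable_lebesgue ac_deriv_continuous[OF ac_deriv_u])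
  have "integrable lebesgue (\<lambda>x. u x * u x)"
  proof (rule Bochner_Integration.integrable_bound)
    show "integrable lebesgue (\<lambda>x. exp (- sqrt v0 * \<bar>x - a\<bar>))"
      using v0_pos by (intro integrable_exp_neg_abs) simp
    have "u x * u x \<le> exp (- sqrt v0 * \<bar>x - a\<bar>) * 1" for x
      using u_pos[of x] u_le_1[of x] u_le[of x] by (intro mult_mono) auto
    then show "AE x in lebesgue. norm (u x * u x) \<le> norm (exp (- sqrt v0 * \<bar>x - a\<bar>))"
      by simp
  qed (use m in auto)
  then show ?thesis using m by (simp add: L2_iff)
qed

lemma u'_L2: "u' \<in> L2"
proof -
  have "p' \<in> borel_measurable lebesgue" "q' \<in> borel_measurable lebesgue"
    using p q solves_continuous by (auto intro: continuous_borel_measurable_lebesgue)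
  then have m: "u' \<in> borel_measurable lebesgue"
    unfolding glue_def[abs_def] by (intro measurable_If) auto
  have "integrable lebesgue (\<lambda>x. u' x * u' x)"
  proof (rule Bochner_Integration.integrable_bound)
    show "integrable lebesgue (\<lambda>x. v1 * (u x * u x))"
      using u_L2 by (simp add: L2_iff)
    have "\<bar>u' x\<bar> * \<bar>u' x\<bar> \<le> (sqrt v1 * u x) * (sqrt v1 * u x)" for x
      using u'_le[of x] by (intro mult_mono) auto
    moreover have "(sqrt v1 * u x) * (sqrt v1 * u x) = v1 * (u x * u x)" for x
      using v0_pos v0_le_v1 by (simp add: algebra_simps)
    ultimately show "AE x in lebesgue. norm (u' x * u' x) \<le> norm (v1 * (u x * u x))"
      using v0_pos v0_le_v1 by (simp add: abs_mult)
  qed (use m in auto)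
  then show ?thesis using m by (simp add: L2_iff)
qed

lemma u_in_K_set: "u \<in> K_set a"
proof -
  have "u \<in> H1" using H1_iff u_L2 u'_L2 ac_deriv_u by blast
  moreover have "u a = 1" by (simp add: glue_def qa)
  moreover have "Linf_norm u = 1"
  proof (rule antisym)
    have "\<bar>u x\<bar> \<le> 1" for x using u_pos[of x] u_le_1[of x] by simp
    then show "Linf_norm u \<le> 1"
      using Linf_norm_leI[of u 1] u_L2 by (simp add: L2_iff one_ereal_def)
    show "1 \<le> Linf_norm u"
      using continuous_abs_le_Linf_norm[OF ac_deriv_continuous[OF ac_deriv_u], of a] \<open>u a = 1\<close>
      by (simp add: one_ereal_def)
  qed
  ultimately show ?thesis by (simp add: K_set_def)
qed

text \<open>
This is the weak form of the Euler-Lagrange equation. On each half line the integrand is the derivative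
of \<open>h u'\<close>. The jump of \<open>u'\<close> at \<open>a\<close> does no harm because \<open>h\<close> vanishes there, so \<open>h u'\<close> is an
indefinite integral across \<open>a\<close>, and it tends to 0 at both ends because \<open>h\<close> is bounded and \<open>u'\<close>
decays.
\<close>

lemma cross_term_vanishes:
  assumes h: "ac_deriv h g" "h \<in> L2" "g \<in> L2" "h a = 0" and B: "\<And>x. \<bar>h x\<bar> \<le> B"
  shows "(LINT x|lebesgue. g x * u' x + V x * u x * h x) = 0"
proof -
  define I where "I x = g x * u' x + h x * (V x * u x)" for x
  have part: "ac_deriv (\<lambda>x. h x * r' x) (\<lambda>x. g x * r' x + h x * (V x * r x))" if "solves V r r'" for r r'
    using that solves_continuous[OF that]
    by (intro ac_deriv_mult[OF h(1)] bounded_V_mult) (auto simp: solves_def)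
  have "ac_deriv (glue a (\<lambda>x. h x * p' x) (\<lambda>x. h x * q' x))
      (glue a (\<lambda>x. g x * p' x + h x * (V x * p x)) (\<lambda>x. g x * q' x + h x * (V x * q x)))"
    using h(4) by (intro ac_deriv_glue part p q) simp
  moreover have "glue a (\<lambda>x. g x * p' x + h x * (V x * p x)) (\<lambda>x. g x * q' x + h x * (V x * q x)) = I"
    "glue a (\<lambda>x. h x * p' x) (\<lambda>x. h x * q' x) = (\<lambda>x. h x * u' x)"
    by (auto simp: glue_def I_def)
  ultimately have ac: "ac_deriv (\<lambda>x. h x * u' x) I" by simp
  have int: "integrable lebesgue I"
    unfolding I_def
    by (intro Bochner_Integration.integrable_add L2_mult_integrable h u'_L2 u_L2 L2_V_mult)
  let ?A = "\<lambda>n::nat. {a - real n..a + real n}"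
  have "(\<Union>n. ?A n) = UNIV"
  proof (intro set_eqI iffI UNIV_I)
    fix x :: real
    obtain n :: nat where "\<bar>x - a\<bar> \<le> real n" using real_arch_simple by blast
    then have "x \<in> ?A n" by auto
    then show "x \<in> (\<Union>n. ?A n)" by blast
  qed
  moreover have "incseq ?A" by (auto simp: incseq_def)
  ultimately have "(\<lambda>n. LINT x:?A n|lebesgue. I x) \<longlonglongrightarrow> (LINT x:UNIV|lebesgue. I x)"
    using set_integral_cont_up[of ?A lebesgue I] int by (simp add: set_integrable_def)
  moreover have "(LINT x:?A n|lebesgue. I x) = h (a + real n) * u' (a + real n) - h (a - real n) * u' (a - real n)" for n
    using set_lebesgue_integral_eq_integral(2)[OF ac_deriv_abs_integrable[OF ac]]
      integral_unique[OF ac_deriv_has_integral[OF ac, of "a - real n" "a + real n"]] by simp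
  ultimately have lim: "(\<lambda>n. h (a + real n) * u' (a + real n) - h (a - real n) * u' (a - real n))
      \<longlonglongrightarrow> (LINT x|lebesgue. I x)"
    by (simp add: set_lebesgue_integral_def)
  have bnd: "\<bar>h x * u' x\<bar> \<le> B * (sqrt v1 * exp (- sqrt v0 * \<bar>x - a\<bar>))" for x
  proof -
    have "\<bar>u' x\<bar> \<le> sqrt v1 * exp (- sqrt v0 * \<bar>x - a\<bar>)"
      using v0_pos v0_le_v1 by (intro order_trans[OF u'_le mult_left_mono[OF u_le]]) simp
    then show ?thesis
      unfolding abs_mult using B[of x] by (intro mult_mono) auto
  qed
  have pow: "(\<lambda>n. exp (- sqrt v0) ^ n) \<longlonglongrightarrow> 0"
    by (rule LIMSEQ_realpow_zero) (use v0_pos in auto)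
  have e: "(\<lambda>n. 2 * (B * (sqrt v1 * exp (- sqrt v0) ^ n))) \<longlonglongrightarrow> 2 * (B * (sqrt v1 * 0))"
    by (intro tendsto_mult_left pow)
  have "(\<lambda>n. h (a + real n) * u' (a + real n) - h (a - real n) * u' (a - real n)) \<longlonglongrightarrow> 0"
  proof (rule Lim_null_comparison)
    have "\<bar>h (a + real n) * u' (a + real n) - h (a - real n) * u' (a - real n)\<bar>
        \<le> 2 * (B * (sqrt v1 * exp (- sqrt v0) ^ n))" for n
      using bnd[of "a + real n"] bnd[of "a - real n"]
      by (simp add: exp_of_nat_mult[symmetric] mult.commute[of "real n"])
    then show "\<forall>\<^sub>F n in sequentially. norm (h (a + real n) * u' (a + real n) - h (a - real n) * u' (a - real n))
        \<le> 2 * (B * (sqrt v1 * exp (- sqrt v0) ^ n))" by simp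
  qed (use e in simp)
  with lim have "(LINT x|lebesgue. I x) = 0" by (rule LIMSEQ_unique)
  then show ?thesis by (simp add: I_def mult_ac)
qed

text \<open>
Pythagoras for the quadratic form: the cross term drops out of the expansion around \<open>u\<close>, and the
excess of \<open>w\<close> over \<open>u\<close> is the quadratic form of \<open>w - u\<close>, which is positive definite.
\<close>

lemma V_norm_sq_excess:
  assumes w: "w \<in> K_set a"
  shows "V_norm_sq V u \<le> V_norm_sq V w" and "V_norm_sq V w \<le> V_norm_sq V u \<Longrightarrow> w = u"
proof -
  obtain wg where wg: "w \<in> L2" "wg \<in> L2" "ac_deriv w wg" using w by (auto simp: K_set_def H1_iff)
  define h where "h x = w x - u x" for x
  define g where "g x = wg x - u' x" for x
  have ac: "ac_deriv h g" unfolding h_def g_def by (intro ac_deriv_diff wg ac_deriv_u)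
  have L2: "h \<in> L2" "g \<in> L2" unfolding h_def g_def by (intro L2_diff wg u_L2 u'_L2)+
  have ha: "h a = 0" using w by (simp add: K_set_def h_def glue_def qa)
  \<comment> \<open>Both functions are bounded by 1: the competitor by its norm, and \<open>u\<close> by its decay.\<close>
  have "\<bar>h x\<bar> \<le> 2" for x
  proof -
    have "\<bar>w x\<bar> \<le> 1"
      using continuous_abs_le_Linf_norm[OF ac_deriv_continuous[OF wg(3)], of x] w
      by (simp add: K_set_def one_ereal_def)
    then show ?thesis using u_pos[of x] u_le_1[of x] by (simp add: h_def abs_le_iff)
  qed
  note cross = cross_term_vanishes[OF ac L2 ha this]
  have i: "integrable lebesgue (\<lambda>x. u' x * u' x + V x * u x * u x)"
    "integrable lebesgue (\<lambda>x. g x * u' x + V x * u x * h x)"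
    "integrable lebesgue (\<lambda>x. g x * g x + V x * h x * h x)"
    by (intro Bochner_Integration.integrable_add L2_mult_integrable L2_V_mult L2 u_L2 u'_L2)+
  have "V_norm_sq V w = (LINT x|lebesgue. wg x * wg x + V x * w x * w x)"
    by (rule V_norm_sq_eq[OF wg(3,2,1)])
  also have "\<dots> = (LINT x|lebesgue. (u' x * u' x + V x * u x * u x)
      + 2 * (g x * u' x + V x * u x * h x) + (g x * g x + V x * h x * h x))"
    by (intro Bochner_Integration.integral_cong) (auto simp: g_def h_def algebra_simps)
  also have "\<dots> = (LINT x|lebesgue. u' x * u' x + V x * u x * u x)
      + 2 * (LINT x|lebesgue. g x * u' x + V x * u x * h x) + (LINT x|lebesgue. g x * g x + V x * h x * h x)"
    using i by (simp only: Bochner_Integration.integral_add Bochner_Integration.integrable_add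
        integrable_mult_right integral_mult_right_zero)
  also have "\<dots> = V_norm_sq V u + (LINT x|lebesgue. g x * g x + V x * h x * h x)"
    unfolding cross V_norm_sq_eq[OF ac_deriv_u u'_L2 u_L2] by simp
  finally have eq: "V_norm_sq V w = V_norm_sq V u + (LINT x|lebesgue. g x * g x + V x * h x * h x)" .
  have nn: "0 \<le> g x * g x" "0 \<le> V x * h x * h x" for x
    using V_pos[of x] by (auto simp: mult.assoc)
  then have Nn: "0 \<le> (LINT x|lebesgue. g x * g x + V x * h x * h x)"
    by (intro Bochner_Integration.integral_nonneg) (simp add: add_nonneg_nonneg)
  then show "V_norm_sq V u \<le> V_norm_sq V w" using eq by simp
  assume "V_norm_sq V w \<le> V_norm_sq V u"
  then have "(LINT x|lebesgue. g x * g x + V x * h x * h x) = 0" using eq Nn by simp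
  then have "AE x in lebesgue. g x * g x + V x * h x * h x = 0"
    using nn i(3) by (subst (asm) integral_nonneg_eq_0_iff_AE) (auto intro!: AE_I2 add_nonneg_nonneg)
  then have "AE x in lebesgue. h x = 0"
  proof eventually_elim
    case (elim x)
    then have "V x * h x * h x = 0" using nn[of x] by (simp add: add_nonneg_eq_0_iff)
    then show ?case using V_pos[of x] by simp
  qed
  then have "h x = 0" for x by (rule continuous_zero_of_AE_zero[OF ac_deriv_continuous[OF ac]])
  then show "w = u" by (auto simp: h_def)
qed

theorem is_minimizer_iff: "is_minimizer V a w \<longleftrightarrow> w = u"
proof
  assume "is_minimizer V a w"
  then have "w \<in> K_set a" "V_norm_sq V w \<le> V_norm_sq V u"
    using u_in_K_set by (auto simp: is_minimizer_def is_arg_min_def not_less)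
  then show "w = u" by (rule V_norm_sq_excess(2))
next
  assume "w = u"
  then show "is_minimizer V a w"
    using u_in_K_set V_norm_sq_excess(1) by (auto simp: is_minimizer_def is_arg_min_def not_less)
qed

end

section \<open>Translation to the given notions of solution and minimizer\<close>

context potential
begin

text \<open>
Two directions of regularity: a \<open>W2inf_loc\<close> solution satisfies the integrated equation because
continuous functions with a second weak derivative are iterated integrals, and conversely a solution of
the integrated equation has locally bounded second derivative \<open>V \<phi>\<close>. Allowing \<open>U\<close> to differ from
\<open>V\<close> on a null set lets a truncated potential stand in for the given one.
\<close>

lemma decaying_solution_iff:
  assumes AE: "AE x in lebesgue. V x = U x"
  shows "decaying_solution U F \<phi> \<longleftrightarrow> (\<exists>\<phi>'. solves V \<phi> \<phi>') \<and> \<phi> 0 = 1 \<and> (\<phi> \<longlongrightarrow> 0) F"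
proof
  assume d: "decaying_solution U F \<phi>"
  then have c: "continuous_on UNIV \<phi>" and "\<exists>g\<in>Linf_loc. has_weak_deriv 2 \<phi> g"
    by (auto simp: decaying_solution_def W2inf_loc_def sobolev_def)
  then obtain \<phi>' g where g: "ac_deriv \<phi> \<phi>'" "ac_deriv \<phi>' g"
    using has_weak_deriv_2_iff[OF c] by blast
  have "AE x in lebesgue. weak_deriv 2 \<phi> x = U x * \<phi> x" using d by (simp add: decaying_solution_def)
  then have "AE x in lebesgue. g x = V x * \<phi> x"
    using weak_deriv_2_AE[OF g] AE by eventually_elim simp
  then have "solves V \<phi> \<phi>'" using g ac_deriv_cong_AE by (auto simp: solves_def)
  then show "(\<exists>\<phi>'. solves V \<phi> \<phi>') \<and> \<phi> 0 = 1 \<and> (\<phi> \<longlongrightarrow> 0) F"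
    using d by (auto simp: decaying_solution_def)
next
  assume "(\<exists>\<phi>'. solves V \<phi> \<phi>') \<and> \<phi> 0 = 1 \<and> (\<phi> \<longlongrightarrow> 0) F"
  then obtain \<phi>' where s: "solves V \<phi> \<phi>'" and \<phi>: "\<phi> 0 = 1" "(\<phi> \<longlongrightarrow> 0) F" by blast
  have ac: "ac_deriv \<phi> \<phi>'" "ac_deriv \<phi>' (\<lambda>x. V x * \<phi> x)" using s by (auto simp: solves_def)
  note c = solves_continuous[OF s]
  have m: "\<phi> \<in> borel_measurable lebesgue" "\<phi>' \<in> borel_measurable lebesgue"
    using c by (auto intro: continuous_borel_measurable_lebesgue)
  have "\<exists>g\<in>Linf_loc. has_weak_deriv j \<phi> g" if j: "j \<le> 2" for j
  proof -
    consider "j = 0" | "j = 1" | "j = 2" using j by linarith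
    then show ?thesis
    proof cases
      case 1
      then show ?thesis
        using c m by (auto intro!: bexI[of _ \<phi>] has_weak_deriv_0_self continuous_L1_loc
            locally_bounded_Linf_loc bounded_image_Icc_of_continuous)
    next
      case 2
      then show ?thesis
        using c m ac(1) has_weak_deriv_1_iff[OF c(1)]
        by (auto intro!: bexI[of _ \<phi>'] locally_bounded_Linf_loc bounded_image_Icc_of_continuous)
    next
      case 3
      have "(\<lambda>x. V x * \<phi> x) \<in> Linf_loc"
        using c m V_measurable
        by (intro locally_bounded_Linf_loc bounded_V_mult) auto
      then show ?thesis using 3 ac has_weak_deriv_2_iff[OF c(1)] by blast
    qed
  qed
  then have "\<phi> \<in> W2inf_loc" using c by (simp add: W2inf_loc_def sobolev_def)
  moreover have "AE x in lebesgue. weak_deriv 2 \<phi> x = U x * \<phi> x"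
    using weak_deriv_2_AE[OF ac] AE by eventually_elim simp
  ultimately show "decaying_solution U F \<phi>" using \<phi> by (simp add: decaying_solution_def)
qed

lemma is_minimizer_cong_AE:
  assumes "AE x in lebesgue. V x = U x"
  shows "is_minimizer U a = is_minimizer V a"
proof -
  have "V_norm_sq U w = V_norm_sq V w" if w: "w \<in> K_set a" for w
    unfolding V_norm_sq_def
  proof (rule integral_cong_AE)
    obtain g where g: "w \<in> L2" "g \<in> L2" "ac_deriv w g" using w by (auto simp: K_set_def H1_iff)
    have "weak_deriv 1 w \<in> borel_measurable lebesgue"
      using borel_measurable_AE[of g "weak_deriv 1 w"] weak_deriv_1_AE(2)[OF g(3)] g(2)
      by (simp add: L2_iff eq_commute)
    moreover have "U \<in> borel_measurable lebesgue" by (rule borel_measurable_AE[OF V_measurable assms])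
    ultimately show "(\<lambda>x. \<bar>weak_deriv 1 w x\<bar>\<^sup>2 + U x * \<bar>w x\<bar>\<^sup>2) \<in> borel_measurable lebesgue"
      "(\<lambda>x. \<bar>weak_deriv 1 w x\<bar>\<^sup>2 + V x * \<bar>w x\<bar>\<^sup>2) \<in> borel_measurable lebesgue"
      using g(1) V_measurable by (auto simp: L2_iff)
    show "AE x in lebesgue. \<bar>weak_deriv 1 w x\<bar>\<^sup>2 + U x * \<bar>w x\<bar>\<^sup>2 = \<bar>weak_deriv 1 w x\<bar>\<^sup>2 + V x * \<bar>w x\<bar>\<^sup>2"
      using assms by eventually_elim simp
  qed
  then show ?thesis by (auto simp: is_minimizer_def is_arg_min_def fun_eq_iff)
qed

lemma is_minimizer_iff_glued_decaying_solutions: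
  assumes m: "solves V \<psi> \<psi>'" "\<psi> 0 = 1" "(\<psi> \<longlongrightarrow> 0) at_bot"
    and p: "solves V \<phi> \<phi>'" "\<phi> 0 = 1" "(\<phi> \<longlongrightarrow> 0) at_top"
  shows "is_minimizer V a w \<longleftrightarrow> w = glue a (\<lambda>x. \<psi> x / \<psi> a) (\<lambda>x. \<phi> x / \<phi> a)"
proof -
  have scale: "solves V (\<lambda>x. r x / c) (\<lambda>x. r' x / c)" if "solves V r r'" for r r' c
    using solves_linear_combination[OF that that, of "1 / c" 0] by simp
  note pb = normalized_decaying_solution[OF p(1,3,2)]
  note mb = normalized_decaying_solution_at_bot[OF m(1,3,2)]
  interpret peaked_profile V v0 v1 a "\<lambda>x. \<psi> x / \<psi> a" "\<lambda>x. \<psi>' x / \<psi> a" "\<lambda>x. \<phi> x / \<phi> a" "\<lambda>x. \<phi>' x / \<phi> a"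
    using pb mb pb[of a a] mb[of a a] by unfold_locales (auto intro: scale m p)
  show ?thesis by (rule is_minimizer_iff)
qed

end

theorem theorem3p5:
  fixes V :: "real \<Rightarrow> real" and v0 v1 :: real
  assumes "V \<in> Linf"
    and "0 < v0"
    and "AE x in lebesgue. v0 \<le> V x \<and> V x \<le> v1"
  shows "(\<exists>!\<phi>p. decaying_solution V at_top \<phi>p) \<and>
         (\<exists>!\<phi>m. decaying_solution V at_bot \<phi>m) \<and>
         (\<forall>\<phi>p \<phi>m. decaying_solution V at_top \<phi>p \<longrightarrow> decaying_solution V at_bot \<phi>m \<longrightarrow>
            (\<forall>x. sqrt (v0 / v1) * exp (- max (sqrt v0 * x) (sqrt v1 * x)) \<le> \<phi>p x \<and>
                 \<phi>p x \<le> sqrt (v1 / v0) * exp (- min (sqrt v0 * x) (sqrt v1 * x))) \<and>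
            (\<forall>x. sqrt (v0 / v1) * exp (min (sqrt v0 * x) (sqrt v1 * x)) \<le> \<phi>m x \<and>
                 \<phi>m x \<le> sqrt (v1 / v0) * exp (max (sqrt v0 * x) (sqrt v1 * x))) \<and>
            (\<forall>a. (\<exists>!u. is_minimizer V a u) \<and>
                 (\<forall>x. minimizer V a x = (if x < a then \<phi>m x / \<phi>m a else \<phi>p x / \<phi>p a))))"
proof -
  \<comment> \<open>The truncation satisfies the bounds at every point and agrees with \<open>V\<close> almost everywhere.\<close>
  define W where "W x = max v0 (min v1 (V x))" for x
  have AE: "AE x in lebesgue. W x = V x"
    using assms(3) by eventually_elim (auto simp: W_def)
  obtain x0 where "v0 \<le> V x0 \<and> V x0 \<le> v1"
    using AE_lebesgue_meets_open[OF assms(3), of UNIV] by auto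
  then have le: "v0 \<le> v1" by linarith
  interpret potential W v0 v1
  proof
    show "W \<in> borel_measurable lebesgue"
      unfolding W_def using assms(1) by (intro borel_measurable_max borel_measurable_min) (auto simp: Linf_def)
  qed (use assms(2) le in \<open>auto simp: W_def\<close>)
  note iff = decaying_solution_iff[OF AE]
  have "\<exists>!\<phi>. decaying_solution V at_top \<phi>"
  proof (rule ex_ex1I)
    show "\<exists>\<phi>. decaying_solution V at_top \<phi>"
      unfolding iff using exists_decaying_solution by metis
    show "\<phi>1 = \<phi>2" if "decaying_solution V at_top \<phi>1" "decaying_solution V at_top \<phi>2" for \<phi>1 \<phi>2
      using that unfolding iff by (metis decaying_solution_unique)
  qed
  moreover have "\<exists>!\<phi>. decaying_solution V at_bot \<phi>"
  proof (rule ex_ex1I)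
    show "\<exists>\<phi>. decaying_solution V at_bot \<phi>"
      unfolding iff using exists_decaying_solution_at_bot by metis
    show "\<phi>1 = \<phi>2" if "decaying_solution V at_bot \<phi>1" "decaying_solution V at_bot \<phi>2" for \<phi>1 \<phi>2
      using that unfolding iff by (metis decaying_solution_at_bot_unique)
  qed
  moreover have "(\<forall>x. sqrt (v0 / v1) * exp (- max (sqrt v0 * x) (sqrt v1 * x)) \<le> \<phi>p x \<and>
                 \<phi>p x \<le> sqrt (v1 / v0) * exp (- min (sqrt v0 * x) (sqrt v1 * x))) \<and>
            (\<forall>x. sqrt (v0 / v1) * exp (min (sqrt v0 * x) (sqrt v1 * x)) \<le> \<phi>m x \<and>
                 \<phi>m x \<le> sqrt (v1 / v0) * exp (max (sqrt v0 * x) (sqrt v1 * x))) \<and>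
            (\<forall>a. (\<exists>!u. is_minimizer V a u) \<and>
                 (\<forall>x. minimizer V a x = (if x < a then \<phi>m x / \<phi>m a else \<phi>p x / \<phi>p a)))"
    if d: "decaying_solution V at_top \<phi>p" "decaying_solution V at_bot \<phi>m" for \<phi>p \<phi>m
  proof -
    obtain \<phi>p' where p: "solves W \<phi>p \<phi>p'" "\<phi>p 0 = 1" "(\<phi>p \<longlongrightarrow> 0) at_top" using d(1) unfolding iff by blast
    obtain \<phi>m' where m: "solves W \<phi>m \<phi>m'" "\<phi>m 0 = 1" "(\<phi>m \<longlongrightarrow> 0) at_bot" using d(2) unfolding iff by blast
    have c: "sqrt (v0 / v1) \<le> 1" "1 \<le> sqrt (v1 / v0)" using le assms(2) by auto
    \<comment> \<open>The solutions satisfy the exponential bounds with constant 1, and the stated constants are weaker.\<close>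
    have lo: "sqrt (v0 / v1) * exp t \<le> y" if "exp t \<le> y" for t y
      using mult_right_mono[OF c(1), of "exp t"] that by (simp only: mult_1) (meson exp_ge_zero order_trans)
    have up: "y \<le> sqrt (v1 / v0) * exp t" if "y \<le> exp t" for t y
      using mult_right_mono[OF c(2), of "exp t"] that by (simp only: mult_1) (meson exp_ge_zero order_trans)
    have min: "is_minimizer V a w \<longleftrightarrow> w = glue a (\<lambda>x. \<phi>m x / \<phi>m a) (\<lambda>x. \<phi>p x / \<phi>p a)" for a w
      unfolding is_minimizer_cong_AE[OF AE] by (rule is_minimizer_iff_glued_decaying_solutions[OF m p])
    have "minimizer V a = glue a (\<lambda>x. \<phi>m x / \<phi>m a) (\<lambda>x. \<phi>p x / \<phi>p a)" for a
      unfolding minimizer_def min by simp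
    then show ?thesis
      using decaying_solution_bounds[OF p(1,3,2)] decaying_solution_at_bot_bounds[OF m(1,3,2)] min
      by (auto simp: glue_def intro!: lo up)
  qed
  ultimately show ?thesis by blast
qed

end
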